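(* Let $n\ge 2$ be an integer and let $H(x,y)=xy+H_{n+1}(x,y)$, where $H_{n+1}\in\mathbb{C}[x,y]$ is homogeneous of degree $n+1$. Consider the system $\frac{dx}{dt}=H_y(x,y)$, $\frac{dy}{dt}=-H_x(x,y)$ on $\mathbb{C}^2$, and let $\omega=\frac{dx}{H_y(x,y)}$. Let $O_j\neq O=(0,0)$ be an isolated singular point of the system lying on $L_0=\{H=0\}$, and let $\gamma_{h,j}\in\mathcal{H}_1(L_h,\mathbb{Z})$ be the vanishing cycle associated to $O_j$, taken with the same orientation as $\gamma_h$. Then, in a neighborhood of $h=0$, the period function $\oint_{\gamma_{h,j}}\omega$ has the form $\frac{2\pi\mathrm{i}}{n-1}+o(1)$, where $o(1)$ tends to $0$ as $h\to0$.
   Context: $L_h=\{(x,y)\in\mathbb{C}^2:H(x,y)=h\}$ and $h\neq0$ is a generic value close to $0$. Every isolated singular point $O_j$ of the system on $L_0$ is a non-degenerate critical point of $H$. The vanishing cycle associated to a non-degenerate critical point $p$ on $L_0$ is the cycle (unique up to orientation) generating the group of cycles in $\mathcal{H}_1(L_h,\mathbb{Z})$ that vanish at $p$ as $h\to0$; it is represented by a continuous family of loops on $L_h$ near $p$ whose length tends to zero as $h\to0$. $\gamma_h$ denotes the vanishing cycle associated to the origin $O$, oriented so that $T(h)=\oint_{\gamma_h}\omega=2\pi\mathrm{i}+o(1)$ as $h\to0$. Explicitly, the orientation convention is: a vanishing cycle at a non-degenerate singular point on $L_0$, where the linearized system has eigenvalues $\lambda,-\lambda$ with $\lambda>0$,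 is oriented so that it winds once counterclockwise around $0$ in the linear eigen-coordinate belonging to the eigenvalue $\lambda$ (at $O$ this is the coordinate $x$, with $\lambda=1$). *)

theory Defs
  imports "HOL-Complex_Analysis.Complex_Analysis" "HOL-Homology.Homology"
begin

definition homogeneous_form :: "nat \<Rightarrow> (complex \<times> complex \<Rightarrow> complex) \<Rightarrow> bool" where
  "homogeneous_form d F \<longleftrightarrow>
     (\<exists>a :: nat \<Rightarrow> complex. \<forall>x y. F (x, y) = (\<Sum>k\<le>d. a k * x ^ k * y ^ (d - k)))"

definition partial_x :: "(complex \<times> complex \<Rightarrow> complex) \<Rightarrow> complex \<times> complex \<Rightarrow> complex" where
  "partial_x H q = deriv (\<lambda>x. H (x, snd q)) (fst q)"

definition partial_y :: "(complex \<times> complex \<Rightarrow> complex) \<Rightarrow> complex \<times> complex \<Rightarrow> complex" where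
  "partial_y H q = deriv (\<lambda>y. H (fst q, y)) (snd q)"

definition level_curve :: "(complex \<times> complex \<Rightarrow> complex) \<Rightarrow> complex \<Rightarrow> (complex \<times> complex) set" where
  "level_curve H h = {q. H q = h}"


subsection \<open>The Hamiltonian system\<close>

definition ham_field :: "(complex \<times> complex \<Rightarrow> complex) \<Rightarrow> complex \<times> complex \<Rightarrow> complex \<times> complex" where
  "ham_field H q = (partial_y H q, - partial_x H q)"

definition singular_points :: "(complex \<times> complex \<Rightarrow> complex) \<Rightarrow> (complex \<times> complex) set" where
  "singular_points H = {q. ham_field H q = 0}"

definition linearization ::
  "(complex \<times> complex \<Rightarrow> complex) \<Rightarrow> complex \<times> complex \<Rightarrow> complex \<times> complex \<Rightarrow> complex \<times> complex" where
  "linearization H p w =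
     (partial_x (partial_y H) p * fst w + partial_y (partial_y H) p * snd w,
      - (partial_x (partial_x H) p * fst w + partial_y (partial_x H) p * snd w))"

text \<open>
  \<open>l\<close> is a linear coordinate that satisfies \<open>dl/dt = \<mu> l\<close> along the linearized system, as \<open>x\<close> does
  at the origin with \<open>\<mu> = 1\<close>; that is, \<open>l\<close> is a left eigenvector of the linearization.
\<close>
definition eigen_coordinate ::
  "(complex \<times> complex \<Rightarrow> complex) \<Rightarrow> complex \<times> complex \<Rightarrow> complex \<Rightarrow> (complex \<times> complex \<Rightarrow> complex) \<Rightarrow> bool" where
  "eigen_coordinate H p \<mu> l \<longleftrightarrow>
     (\<exists>a b. (a, b) \<noteq> (0, 0) \<and> l = (\<lambda>w. a * fst w + b * snd w)) \<and>
     (\<forall>w. l (linearization H p w) = \<mu> * l w)"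


subsection \<open>Homology classes of loops and periods\<close>

definition C1_loop_in :: "(complex \<times> complex) set \<Rightarrow> (real \<Rightarrow> complex \<times> complex) \<Rightarrow> bool" where
  "C1_loop_in S g \<longleftrightarrow> valid_path g \<and> pathfinish g = pathstart g \<and> path_image g \<subseteq> S"

definition loop_length :: "(real \<Rightarrow> complex \<times> complex) \<Rightarrow> real" where
  "loop_length g = integral {0..1} (\<lambda>t. norm (vector_derivative g (at t within {0..1})))"

text \<open>
  The class of a loop in \<open>homology_group 1 (top_of_set S)\<close>: the loop is read as a singular
  1-simplex through the barycentric coordinate \<open>v 1\<close>, which runs from 0 to 1.
\<close>
definition loop_class ::
  "(complex \<times> complex) set \<Rightarrow> (real \<Rightarrow> complex \<times> complex) \<Rightarrow> (complex \<times> complex) chain set" where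
  "loop_class S g =
     homologous_rel_set 1 (top_of_set S) {} (frag_of (restrict (\<lambda>v. g (v 1)) (standard_simplex 1)))"

text \<open>
  The form \<open>dx / H_y\<close> on a level curve, evaluated at the point \<open>q\<close> on a tangent vector \<open>v\<close>. Since
  \<open>H_x dx + H_y dy = 0\<close> on the curve, it equals \<open>- dy / H_x\<close>, which extends it holomorphically
  across the points of a smooth level curve at which \<open>H_y\<close> vanishes.
\<close>
definition omega :: "(complex \<times> complex \<Rightarrow> complex) \<Rightarrow> complex \<times> complex \<Rightarrow> complex \<times> complex \<Rightarrow> complex" where
  "omega H q v =
     (if partial_y H q \<noteq> 0 then fst v / partial_y H q else - snd v / partial_x H q)"

definition has_omega_integral ::
  "(complex \<times> complex \<Rightarrow> complex) \<Rightarrow> (real \<Rightarrow> complex \<times> complex) \<Rightarrow> complex \<Rightarrow> bool" where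
  "has_omega_integral H g I \<longleftrightarrow>
     ((\<lambda>t. omega H (g t) (vector_derivative g (at t within {0..1}))) has_integral I) {0..1}"

text \<open>
  The integral of \<open>omega\<close> over a homology class of the level curve at \<open>h\<close>. It is the common
  value over all piecewise \<open>C\<^sup>1\<close> loops on the curve that represent the class, so it is
  meaningful for smooth level curves and for classes of loops.
\<close>
definition period ::
  "(complex \<times> complex \<Rightarrow> complex) \<Rightarrow> complex \<Rightarrow> (complex \<times> complex) chain set \<Rightarrow> complex" where
  "period H h c =
     (THE I. \<exists>g. C1_loop_in (level_curve H h) g \<and> loop_class (level_curve H h) g = c \<and>
                 has_omega_integral H g I)"


subsection \<open>Vanishing cycles\<close>

definition vanishing_loops ::
  "(complex \<times> complex \<Rightarrow> complex) \<Rightarrow> complex \<times> complex \<Rightarrow> (complex \<Rightarrow> real \<Rightarrow> complex \<times> complex) \<Rightarrow> bool" where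
  "vanishing_loops H p \<gamma> \<longleftrightarrow>
     (\<exists>\<delta>>0. continuous_on ((ball 0 \<delta> - {0}) \<times> {0..1}) (\<lambda>(h, t). \<gamma> h t) \<and>
            (\<forall>h \<in> ball 0 \<delta> - {0}. C1_loop_in (level_curve H h) (\<gamma> h))) \<and>
     (\<forall>\<epsilon>>0. \<forall>\<^sub>F h in at 0. path_image (\<gamma> h) \<subseteq> ball p \<epsilon>) \<and>
     ((\<lambda>h. loop_length (\<gamma> h)) \<longlongrightarrow> 0) (at 0)"

text \<open>
  A cycle vanishing at \<open>p\<close> is a family of classes, one for each small \<open>h \<noteq> 0\<close>. Two families
  are identified if they agree for all \<open>h\<close> sufficiently close to 0.
\<close>
definition represents ::
  "(complex \<times> complex \<Rightarrow> complex) \<Rightarrow> (complex \<Rightarrow> real \<Rightarrow> complex \<times> complex) \<Rightarrow>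
   (complex \<Rightarrow> (complex \<times> complex) chain set) \<Rightarrow> bool" where
  "represents H \<gamma> c \<longleftrightarrow> (\<forall>\<^sub>F h in at 0. loop_class (level_curve H h) (\<gamma> h) = c h)"

definition vanishing_cycle ::
  "(complex \<times> complex \<Rightarrow> complex) \<Rightarrow> complex \<times> complex \<Rightarrow>
   (complex \<Rightarrow> (complex \<times> complex) chain set) \<Rightarrow> bool" where
  "vanishing_cycle H p c \<longleftrightarrow>
     (\<exists>\<gamma>. vanishing_loops H p \<gamma> \<and> represents H \<gamma> c) \<and>
     (\<forall>\<gamma>'. vanishing_loops H p \<gamma>' \<longrightarrow>
        (\<exists>k :: int. represents H \<gamma>'
           (\<lambda>h. c h [^]\<^bsub>homology_group 1 (top_of_set (level_curve H h))\<^esub> k)))"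

text \<open>
  The winding number in the linear eigen-coordinate \<open>l\<close> is read off a representative that lives
  on the scale \<open>sqrt \<bar>h\<bar>\<close> of the linear model \<open>u v = h\<close>. On this scale \<open>l\<close> does not vanish on
  the level curve. On a coarser scale it can: for \<open>H = u v + v^3\<close> the level curve meets
  \<open>u = 0\<close> where \<open>v^3 = h\<close>, and homologous loops shrinking to the origin may then have different
  winding numbers in \<open>u\<close>.
\<close>
definition positively_oriented ::
  "(complex \<times> complex \<Rightarrow> complex) \<Rightarrow> complex \<times> complex \<Rightarrow>
   (complex \<Rightarrow> (complex \<times> complex) chain set) \<Rightarrow> bool" where
  "positively_oriented H p c \<longleftrightarrow>
     (\<exists>\<gamma> C l. \<exists>\<mu>::real. vanishing_loops H p \<gamma> \<and> represents H \<gamma> c \<and>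
        (\<forall>\<^sub>F h in at 0. loop_length (\<gamma> h) \<le> C * sqrt (cmod h) \<and>
                        path_image (\<gamma> h) \<subseteq> cball p (C * sqrt (cmod h))) \<and>
        \<mu> > 0 \<and> eigen_coordinate H p (of_real \<mu>) l \<and>
        (\<forall>\<^sub>F h in at 0. 0 \<notin> path_image (\<lambda>t. l (\<gamma> h t - p)) \<and>
                        winding_number (\<lambda>t. l (\<gamma> h t - p)) 0 = 1))"

end

theory Submission
  imports Defs
begin

text \<open>
  On a level curve of \<open>H\<close> the form \<open>omega\<close> is the time differential \<open>dt\<close> of the Hamiltonian flow.
  Near a non-degenerate singular point with eigenvalues \<open>\<mu>\<close> and \<open>-\<mu>\<close>, a linear eigen-coordinate
  \<open>l\<close> satisfies \<open>dl/dt = \<mu> l\<close> to first order. Hence \<open>omega\<close> is close to \<open>dl / (\<mu> l)\<close>, and its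
  integral over a small loop that winds once around \<open>l = 0\<close> tends to \<open>2 \<pi> i / \<mu>\<close>. This is
  \<open>vanishing_cycle_period\<close>, and it holds for every entire \<open>H\<close> whose level curves at small values \<open>h \<noteq> 0\<close> are smooth.
  For \<open>H = x y + H\<^sub>n\<^sub>+\<^sub>1\<close>, Euler's identities force a singular point on \<open>H = 0\<close> to lie on a coordinate
  axis, and away from the origin its positive eigenvalue is \<open>n - 1\<close> (\<open>positive_eigenvalue\<close>).

  Two points need care. The period is an integral over a homology class, so one first has to know
  that homologous loops on a smooth level curve give the same integral
  (\<open>homologous_loops_same_integral\<close>). Locally the form has primitives, by the implicit function theorem;
  iterated barycentric subdivision makes a bounding 2-chain so fine that each of its triangles lies
  in the domain of one primitive. The smoothness itself comes from the finiteness of the set of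
  critical values of \<open>H\<close> (\<open>smooth_near_0\<close>).

  The other point is the limit. With \<open>\<rho> = sqrt \<bar>h\<bar>\<close>, the part of the level curve at distance
  \<open>O(\<rho>)\<close> from the singular point is a graph over an annulus \<open>c \<rho> < \<bar>l\<bar> < C \<rho>\<close>. There
  the difference \<open>omega - dl / (\<mu> l)\<close> is \<open>o(1/\<rho>) dl\<close>, and by Cauchy's theorem it may be integrated over
  a circle, whose length is \<open>O(\<rho>)\<close> (\<open>annulus_integral\<close>).
\<close>

section \<open>Integrals of closed forms and singular homology\<close>

text \<open>
  The pairing of an integral chain with a cochain \<open>\<phi>\<close> with complex values.
\<close>

definition chain_eval :: "('s \<Rightarrow> complex) \<Rightarrow> ('s \<Rightarrow>\<^sub>0 int) \<Rightarrow> complex" where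
  "chain_eval \<phi> c = (\<Sum>\<sigma>\<in>Poly_Mapping.keys c. of_int (poly_mapping.lookup c \<sigma>) * \<phi> \<sigma>)"

lemma chain_eval_superset:
  assumes "finite A" "Poly_Mapping.keys c \<subseteq> A"
  shows "chain_eval \<phi> c = (\<Sum>\<sigma>\<in>A. of_int (poly_mapping.lookup c \<sigma>) * \<phi> \<sigma>)"
  unfolding chain_eval_def
  by (rule sum.mono_neutral_left) (use assms in \<open>auto simp: in_keys_iff\<close>)

lemma chain_eval_0 [simp]: "chain_eval \<phi> 0 = 0"
  by (simp add: chain_eval_def)

lemma chain_eval_of [simp]: "chain_eval \<phi> (frag_of \<sigma>) = \<phi> \<sigma>"
  by (simp add: chain_eval_def)

lemma chain_eval_diff: "chain_eval \<phi> (c - d) = chain_eval \<phi> c - chain_eval \<phi> d"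
proof -
  let ?A = "Poly_Mapping.keys c \<union> Poly_Mapping.keys d"
  have "Poly_Mapping.keys (c - d) \<subseteq> ?A"
    by (rule keys_diff)
  then show ?thesis
    by (simp add: chain_eval_superset[of ?A] lookup_minus sum_subtractf left_diff_distrib)
qed

lemma chain_eval_add: "chain_eval \<phi> (c + d) = chain_eval \<phi> c + chain_eval \<phi> d"
  using chain_eval_diff[of \<phi> "c + d" d] by simp

lemma chain_boundary_1_of:
  "chain_boundary (Suc 0) (frag_of \<tau>) = frag_of (singular_face 1 0 \<tau>) - frag_of (singular_face 1 1 \<tau>)"
  by (simp add: chain_boundary_of)

lemma chain_boundary_2_of:
  "chain_boundary 2 (frag_of \<tau>) =
     frag_of (singular_face 2 0 \<tau>) - frag_of (singular_face 2 1 \<tau>) + frag_of (singular_face 2 2 \<tau>)"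
  by (simp add: chain_boundary_of numeral_2_eq_2)

abbreviation vertex :: "nat \<Rightarrow> nat \<Rightarrow> real" where
  "vertex i \<equiv> (\<lambda>j. if j = i then 1 else 0)"

lemma simplical_face_vertex:
  "simplical_face k (vertex i) = vertex (if i < k then i else Suc i)"
  by (auto simp: simplical_face_def fun_eq_iff)

lemma chain_map_iterated_subdivision:
  assumes "singular_chain p X c" "continuous_map X Y g"
  shows "(singular_subdivision p ^^ m) (chain_map p g c) = chain_map p g ((singular_subdivision p ^^ m) c)
    \<and> singular_chain p X ((singular_subdivision p ^^ m) c)"
  by (induction m)
    (use assms in \<open>auto simp: naturality_singular_subdivision singular_chain_singular_subdivision\<close>)

lemma chain_boundary_iterated_subdivision:
  assumes "singular_chain p X c"
  shows "chain_boundary p ((singular_subdivision p ^^ m) c) = (singular_subdivision (p - 1) ^^ m) (chain_boundary p c)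
    \<and> singular_chain p X ((singular_subdivision p ^^ m) c)"
  by (induction m)
    (use assms in \<open>auto simp: chain_boundary_singular_subdivision singular_chain_singular_subdivision\<close>)

lemma iterated_subdivision_0:
  assumes "singular_chain 0 X c"
  shows "(singular_subdivision 0 ^^ m) c = c"
  by (induction m) (use assms in \<open>auto simp: singular_subdivision_zero\<close>)

lemma connectedin_simplex_image:
  assumes "singular_simplex p X \<sigma>"
  shows "connectedin X (\<sigma> ` standard_simplex p)"
proof -
  have "connectedin (subtopology (powertop_real UNIV) (standard_simplex p)) (standard_simplex p)"
    by (simp add: connectedin_subtopology connectedin_standard_simplex)
  then show ?thesis
    using assms unfolding singular_simplex_def by (meson connectedin_continuous_map_image)
qed

lemma eventually_small_subdivision:
  assumes "\<And>U. U \<in> \<C> \<Longrightarrow> openin X U" "topspace X \<subseteq> \<Union>\<C>" "singular_chain p X c"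
  shows "\<exists>N. \<forall>m\<ge>N. \<forall>\<sigma>\<in>Poly_Mapping.keys ((singular_subdivision p ^^ m) c).
    \<exists>U\<in>\<C>. \<sigma> \<in> standard_simplex p \<rightarrow> U"
proof (rule sufficient_iterated_singular_subdivision_exists)
  fix N
  assume "\<And>m \<sigma>. N \<le> m \<Longrightarrow> \<sigma> \<in> Poly_Mapping.keys ((singular_subdivision p ^^ m) c) \<Longrightarrow>
    \<exists>U\<in>\<C>. \<sigma> \<in> standard_simplex p \<rightarrow> U"
  then show ?thesis by blast
qed (use assms in auto)

text \<open>
  A closed 1-form, given only through primitives on the sets of an open cover. That two primitives
  differ by a constant on each connected set on which both are defined is what makes them primitives
  of one and the same form.
\<close>

locale local_primitives =
  fixes X :: "'a topology" and \<C> :: "'a set set" and F :: "'a set \<Rightarrow> 'a \<Rightarrow> complex"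
  assumes cover_open: "U \<in> \<C> \<Longrightarrow> openin X U"
    and cover: "topspace X \<subseteq> \<Union>\<C>"
    and overlap: "U \<in> \<C> \<Longrightarrow> V \<in> \<C> \<Longrightarrow> connectedin X T \<Longrightarrow> T \<subseteq> U \<Longrightarrow> T \<subseteq> V \<Longrightarrow> a \<in> T \<Longrightarrow> b \<in> T \<Longrightarrow>
      F U b - F U a = F V b - F V a"
begin

text \<open>
  The integral of the form over a 1-simplex that lies in a set of the cover. For larger simplices
  the value is meaningless; subdivision removes them.
\<close>

definition increment :: "((nat \<Rightarrow> real) \<Rightarrow> 'a) \<Rightarrow> complex" where
  "increment \<sigma> = (let U = SOME U. U \<in> \<C> \<and> \<sigma> ` standard_simplex 1 \<subseteq> U
                  in F U (\<sigma> (vertex 1)) - F U (\<sigma> (vertex 0)))"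

lemma increment_eq:
  assumes "singular_simplex 1 X \<sigma>" "U \<in> \<C>" "\<sigma> ` standard_simplex 1 \<subseteq> U"
  shows "increment \<sigma> = F U (\<sigma> (vertex 1)) - F U (\<sigma> (vertex 0))"
proof -
  define V where "V = (SOME U. U \<in> \<C> \<and> \<sigma> ` standard_simplex 1 \<subseteq> U)"
  have "V \<in> \<C> \<and> \<sigma> ` standard_simplex 1 \<subseteq> V"
    unfolding V_def by (rule someI) (use assms in blast)
  then have "F V (\<sigma> (vertex 1)) - F V (\<sigma> (vertex 0)) = F U (\<sigma> (vertex 1)) - F U (\<sigma> (vertex 0))"
    using assms connectedin_simplex_image[OF assms(1)]
    by (intro overlap[where T = "\<sigma> ` standard_simplex 1"]) auto
  then show ?thesis
    by (simp add: increment_def Let_def V_def)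
qed

text \<open>
  Stokes' theorem for small triangles: a primitive on a set that contains the triangle evaluates
  all three edges, and its vertex values cancel.
\<close>

lemma increment_boundary:
  assumes "Poly_Mapping.keys c \<subseteq> {\<sigma>. singular_simplex 2 X \<sigma> \<and> (\<exists>U\<in>\<C>. \<sigma> ` standard_simplex 2 \<subseteq> U)}"
  shows "chain_eval increment (chain_boundary 2 c) = 0"
  using assms
proof (induction rule: frag_induction)
  case (one \<sigma>)
  then obtain U where \<sigma>: "singular_simplex 2 X \<sigma>" and U: "U \<in> \<C>" "\<sigma> ` standard_simplex 2 \<subseteq> U"
    by blast
  have face: "increment (singular_face 2 k \<sigma>) =
      F U (\<sigma> (simplical_face k (vertex 1))) - F U (\<sigma> (simplical_face k (vertex 0)))" if "k \<le> 2" for k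
  proof -
    have "simplical_face k v \<in> standard_simplex 2" if "v \<in> standard_simplex 1" for v :: "nat \<Rightarrow> real"
      using simplical_face_in_standard_simplex[of 2 k v] \<open>k \<le> 2\<close> that by simp
    then have "singular_face 2 k \<sigma> ` standard_simplex 1 \<subseteq> U"
      using U(2) by (auto simp: singular_face_def)
    moreover have "singular_simplex 1 X (singular_face 2 k \<sigma>)"
      using singular_simplex_singular_face[OF \<sigma>, of k] that by simp
    ultimately show ?thesis
      using increment_eq[OF _ U(1)] by (simp add: singular_face_def)
  qed
  show ?case
    unfolding chain_boundary_2_of chain_eval_add chain_eval_diff chain_eval_of
    using face[of 0] face[of 1] face[of 2] by (simp add: simplical_face_vertex numeral_2_eq_2)
qed (simp_all add: chain_boundary_diff chain_eval_diff)

text \<open>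
  The integral \<open>f\<close> of the form along a path \<open>g\<close> is a primitive of the form pulled back to
  \<open>{0..1}\<close>, and it is defined on the whole interval. So on chains of the form \<open>g \<circ> \<tau>\<close> the sum of the
  small increments only depends on the boundary of the chain in the interval.
\<close>

lemma increment_along_path:
  assumes g: "continuous_map (top_of_set {0..1::real}) X g"
    and f: "\<And>U T s t. U \<in> \<C> \<Longrightarrow> connected T \<Longrightarrow> T \<subseteq> {0..1} \<Longrightarrow> g ` T \<subseteq> U \<Longrightarrow> s \<in> T \<Longrightarrow> t \<in> T \<Longrightarrow>
      f t - f s = F U (g t) - F U (g s)"
    and d: "Poly_Mapping.keys d \<subseteq> {\<tau>. singular_simplex 1 (top_of_set {0..1}) \<tau> \<and> (\<exists>U\<in>\<C>. g ` \<tau> ` standard_simplex 1 \<subseteq> U)}"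
  shows "chain_eval increment (chain_map 1 g d) = chain_eval (\<lambda>s. f (s (vertex 0))) (chain_boundary 1 d)"
  using d
proof (induction rule: frag_induction)
  case (one \<tau>)
  then obtain U where \<tau>: "singular_simplex 1 (top_of_set {0..1}) \<tau>"
    and U: "U \<in> \<C>" "g ` \<tau> ` standard_simplex 1 \<subseteq> U"
    by blast
  have conn: "connectedin (top_of_set {0..1}) (\<tau> ` standard_simplex 1)"
    by (rule connectedin_simplex_image[OF \<tau>])
  have "increment (simplex_map 1 g \<tau>) = F U (g (\<tau> (vertex 1))) - F U (g (\<tau> (vertex 0)))"
    using increment_eq[OF singular_simplex_simplex_map[OF \<tau> g] U(1)] U(2)
    by (auto simp: simplex_map_def)
  also have "\<dots> = f (\<tau> (vertex 1)) - f (\<tau> (vertex 0))"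
    by (rule f[symmetric, where T = "\<tau> ` standard_simplex 1"])
      (use U conn in \<open>auto simp: connectedin_subtopology\<close>)
  finally show ?case
    by (simp add: chain_boundary_1_of chain_eval_diff singular_face_def simplical_face_vertex)
qed (simp_all add: chain_boundary_diff chain_eval_diff chain_map_diff)

text \<open>
  Subdivision does not change the boundary of the interval, since it is the identity on 0-chains.
  Therefore the increments of a sufficiently subdivided path add up to its full integral, and the
  shape of the subdivision never has to be examined. The cover of the interval by preimages is
  used, rather than the cover of \<open>X\<close>, because simplices may cancel after composition with \<open>g\<close>.
\<close>

lemma increment_subdivided_path:
  assumes g: "continuous_map (top_of_set {0..1::real}) X g"
    and f: "\<And>U T s t. U \<in> \<C> \<Longrightarrow> connected T \<Longrightarrow> T \<subseteq> {0..1} \<Longrightarrow> g ` T \<subseteq> U \<Longrightarrow> s \<in> T \<Longrightarrow> t \<in> T \<Longrightarrow>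
      f t - f s = F U (g t) - F U (g s)"
  shows "\<exists>N. \<forall>m\<ge>N. chain_eval increment ((singular_subdivision 1 ^^ m)
      (frag_of (restrict (\<lambda>v. g (v 1)) (standard_simplex 1)))) = f 1 - f 0"
proof -
  let ?I = "top_of_set {0..1::real}"
  define \<iota> :: "(nat \<Rightarrow> real) \<Rightarrow> real" where "\<iota> = restrict (\<lambda>v. v 1) (standard_simplex 1)"
  have "continuous_map (subtopology (powertop_real UNIV) (standard_simplex 1)) euclideanreal (\<lambda>v. v 1)"
    by (intro continuous_map_from_subtopology continuous_map_product_projection) auto
  then have "singular_simplex 1 ?I \<iota>"
    unfolding singular_simplex_def \<iota>_def
    by (auto simp: continuous_map_in_subtopology standard_simplex_def)
  then have \<iota>: "singular_chain 1 ?I (frag_of \<iota>)"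
    by (simp add: singular_chain_of)
  have g\<iota>: "frag_of (restrict (\<lambda>v. g (v 1)) (standard_simplex 1)) = chain_map 1 g (frag_of \<iota>)"
    by (auto simp: simplex_map_def \<iota>_def frag_of_eq)
  define \<D> where "\<D> = (\<lambda>U. {t \<in> {0..1}. g t \<in> U}) ` \<C>"
  have \<D>_open: "openin ?I W" if "W \<in> \<D>" for W
    using that openin_continuous_map_preimage[OF g cover_open] by (auto simp: \<D>_def)
  have \<D>_cover: "topspace ?I \<subseteq> \<Union>\<D>"
    using cover continuous_map_image_subset_topspace[OF g] by (fastforce simp: \<D>_def)
  obtain N where N: "\<forall>m\<ge>N. \<forall>\<tau>\<in>Poly_Mapping.keys ((singular_subdivision 1 ^^ m) (frag_of \<iota>)).
      \<exists>W\<in>\<D>. \<tau> \<in> standard_simplex 1 \<rightarrow> W"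
    using eventually_small_subdivision[OF \<D>_open \<D>_cover \<iota>] by (rule exE)
  show ?thesis
  proof (intro exI allI impI)
    fix m assume "N \<le> m"
    let ?d = "(singular_subdivision 1 ^^ m) (frag_of \<iota>)"
    have d: "singular_chain 1 ?I ?d" "chain_boundary 1 ?d = (singular_subdivision 0 ^^ m) (chain_boundary 1 (frag_of \<iota>))"
      using chain_boundary_iterated_subdivision[OF \<iota>, of m] by simp_all
    have small: "Poly_Mapping.keys ?d \<subseteq> {\<tau>. singular_simplex 1 ?I \<tau> \<and> (\<exists>U\<in>\<C>. g ` \<tau> ` standard_simplex 1 \<subseteq> U)}"
    proof
      fix \<tau> assume \<tau>: "\<tau> \<in> Poly_Mapping.keys ?d"
      then obtain U where "U \<in> \<C>" "\<tau> \<in> standard_simplex 1 \<rightarrow> {t \<in> {0..1}. g t \<in> U}"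
        using N \<open>N \<le> m\<close> \<tau> unfolding \<D>_def by blast
      then show "\<tau> \<in> {\<tau>. singular_simplex 1 ?I \<tau> \<and> (\<exists>U\<in>\<C>. g ` \<tau> ` standard_simplex 1 \<subseteq> U)}"
        using d(1) \<tau> by (auto simp: singular_chain_def)
    qed
    have "chain_eval increment (chain_map 1 g ?d) = chain_eval (\<lambda>s. f (s (vertex 0))) (chain_boundary 1 ?d)"
      by (rule increment_along_path[OF g f small])
    also have "chain_boundary 1 ?d = chain_boundary 1 (frag_of \<iota>)"
      using d(2) iterated_subdivision_0[of ?I "chain_boundary 1 (frag_of \<iota>)" m]
        singular_chain_boundary[OF \<iota>] by simp
    also have "chain_eval (\<lambda>s. f (s (vertex 0))) (chain_boundary 1 (frag_of \<iota>)) = f 1 - f 0"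
      by (simp add: chain_boundary_1_of chain_eval_diff singular_face_def simplical_face_vertex \<iota>_def)
    finally show "chain_eval increment ((singular_subdivision 1 ^^ m)
        (frag_of (restrict (\<lambda>v. g (v 1)) (standard_simplex 1)))) = f 1 - f 0"
      unfolding g\<iota> using chain_map_iterated_subdivision[OF \<iota> g, of m] by simp
  qed
qed

text \<open>
  After subdivision, the 2-chain that bounds the difference of the two paths consists of small
  triangles, over whose boundaries the increments vanish.
\<close>

lemma homologous_paths_increment:
  assumes "continuous_map (top_of_set {0..1::real}) X g1"
    and "\<And>U T s t. U \<in> \<C> \<Longrightarrow> connected T \<Longrightarrow> T \<subseteq> {0..1} \<Longrightarrow> g1 ` T \<subseteq> U \<Longrightarrow> s \<in> T \<Longrightarrow> t \<in> T \<Longrightarrow>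
      f1 t - f1 s = F U (g1 t) - F U (g1 s)"
    and "continuous_map (top_of_set {0..1::real}) X g2"
    and "\<And>U T s t. U \<in> \<C> \<Longrightarrow> connected T \<Longrightarrow> T \<subseteq> {0..1} \<Longrightarrow> g2 ` T \<subseteq> U \<Longrightarrow> s \<in> T \<Longrightarrow> t \<in> T \<Longrightarrow>
      f2 t - f2 s = F U (g2 t) - F U (g2 s)"
    and "homologous_rel 1 X {} (frag_of (restrict (\<lambda>v. g1 (v 1)) (standard_simplex 1)))
          (frag_of (restrict (\<lambda>v. g2 (v 1)) (standard_simplex 1)))"
  shows "f1 1 - f1 0 = f2 1 - f2 0"
proof -
  let ?\<sigma> = "\<lambda>g. frag_of (restrict (\<lambda>v. g (v 1)) (standard_simplex 1))"
  obtain c where c: "singular_chain 2 X c" "chain_boundary 2 c = ?\<sigma> g1 - ?\<sigma> g2"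
    using assms(5) unfolding homologous_rel_def singular_boundary by (auto simp: numeral_2_eq_2)
  obtain N0 where N0: "\<forall>m\<ge>N0. \<forall>\<tau>\<in>Poly_Mapping.keys ((singular_subdivision 2 ^^ m) c).
      \<exists>U\<in>\<C>. \<tau> \<in> standard_simplex 2 \<rightarrow> U"
    using eventually_small_subdivision[OF cover_open cover c(1)] by (rule exE)
  have "\<exists>N. \<forall>m\<ge>N. chain_eval increment ((singular_subdivision 1 ^^ m) (?\<sigma> g1)) = f1 1 - f1 0"
    by (rule increment_subdivided_path) (fact assms)+
  then obtain N1 where N1: "\<And>m. N1 \<le> m \<Longrightarrow> chain_eval increment ((singular_subdivision 1 ^^ m) (?\<sigma> g1)) = f1 1 - f1 0"
    by blast
  have "\<exists>N. \<forall>m\<ge>N. chain_eval increment ((singular_subdivision 1 ^^ m) (?\<sigma> g2)) = f2 1 - f2 0"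
    by (rule increment_subdivided_path) (fact assms)+
  then obtain N2 where N2: "\<And>m. N2 \<le> m \<Longrightarrow> chain_eval increment ((singular_subdivision 1 ^^ m) (?\<sigma> g2)) = f2 1 - f2 0"
    by blast
  define m where "m = max N0 (max N1 N2)"
  let ?c = "(singular_subdivision 2 ^^ m) c"
  have sub: "singular_chain 2 X ?c" "chain_boundary 2 ?c = (singular_subdivision 1 ^^ m) (?\<sigma> g1 - ?\<sigma> g2)"
    using chain_boundary_iterated_subdivision[OF c(1), of m] c(2) by simp_all
  have "Poly_Mapping.keys ?c \<subseteq> {\<sigma>. singular_simplex 2 X \<sigma> \<and> (\<exists>U\<in>\<C>. \<sigma> ` standard_simplex 2 \<subseteq> U)}"
  proof
    fix \<sigma> assume \<sigma>: "\<sigma> \<in> Poly_Mapping.keys ?c"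
    have "N0 \<le> m" by (simp add: m_def)
    with N0 \<sigma> obtain U where "U \<in> \<C>" "\<sigma> \<in> standard_simplex 2 \<rightarrow> U" by meson
    moreover have "singular_simplex 2 X \<sigma>"
      using subsetD[OF sub(1)[unfolded singular_chain_def] \<sigma>] by (rule CollectD)
    ultimately show "\<sigma> \<in> {\<sigma>. singular_simplex 2 X \<sigma> \<and> (\<exists>U\<in>\<C>. \<sigma> ` standard_simplex 2 \<subseteq> U)}"
      unfolding image_subset_iff_funcset by (intro CollectI conjI bexI)
  qed
  then have "0 = chain_eval increment (chain_boundary 2 ?c)"
    by (rule increment_boundary[symmetric])
  also have "\<dots> = (f1 1 - f1 0) - (f2 1 - f2 0)"
    unfolding sub(2) singular_subdivision_power_diff chain_eval_diff
    using N1[of m] N2[of m] by (simp add: m_def)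
  finally show ?thesis by simp
qed

end

section \<open>Holomorphic functions of two variables and implicit functions\<close>

text \<open>
  Entire functions of two variables, in the form in which they are differentiated below: the real
  derivative is complex linear.
\<close>

definition holomorphic2 :: "(complex \<times> complex \<Rightarrow> complex) \<Rightarrow> bool" where
  "holomorphic2 F \<longleftrightarrow> (\<forall>q. \<exists>a b. (F has_derivative (\<lambda>v. a * fst v + b * snd v)) (at q))"

lemma has_derivative_pair_partials:
  assumes "(F has_derivative (\<lambda>v. a * fst v + b * snd v)) (at q)"
  shows "partial_x F q = a" "partial_y F q = b"
proof -
  have "((\<lambda>x. F (x, snd q)) has_derivative (\<lambda>v. a * v)) (at (fst q))"
  proof -
    have "((F \<circ> (\<lambda>x. (x, snd q))) has_derivative ((\<lambda>v. a * fst v + b * snd v) \<circ> (\<lambda>v. (v, 0)))) (at (fst q))"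
      by (rule diff_chain_at) (use assms in \<open>auto intro!: derivative_eq_intros\<close>)
    then show ?thesis by (simp add: o_def)
  qed
  then show "partial_x F q = a"
    unfolding partial_x_def by (intro DERIV_imp_deriv) (simp add: has_field_derivative_def)
  have "((\<lambda>y. F (fst q, y)) has_derivative (\<lambda>v. b * v)) (at (snd q))"
  proof -
    have "((F \<circ> (\<lambda>y. (fst q, y))) has_derivative ((\<lambda>v. a * fst v + b * snd v) \<circ> (\<lambda>v. (0, v)))) (at (snd q))"
      by (rule diff_chain_at) (use assms in \<open>auto intro!: derivative_eq_intros\<close>)
    then show ?thesis by (simp add: o_def)
  qed
  then show "partial_y F q = b"
    unfolding partial_y_def by (intro DERIV_imp_deriv) (simp add: has_field_derivative_def)
qed

lemma holomorphic2_has_derivative: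
  assumes "holomorphic2 F"
  shows "(F has_derivative (\<lambda>v. partial_x F q * fst v + partial_y F q * snd v)) (at q)"
  using assms has_derivative_pair_partials unfolding holomorphic2_def by metis

lemma holomorphic2_partial_y_field:
  assumes "holomorphic2 F"
  shows "((\<lambda>y. F (x, y)) has_field_derivative partial_y F (x, y)) (at y within S)"
proof -
  have "((F \<circ> (\<lambda>y. (x, y))) has_derivative
      ((\<lambda>v. partial_x F (x, y) * fst v + partial_y F (x, y) * snd v) \<circ> (\<lambda>v. (0, v)))) (at y)"
    by (rule diff_chain_at)
      (use holomorphic2_has_derivative[OF assms, of "(x, y)"] in \<open>auto intro!: derivative_eq_intros\<close>)
  then show ?thesis
    by (auto simp: has_field_derivative_def o_def intro: has_derivative_at_withinI)
qed

lemma holomorphic2_compose: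
  assumes "holomorphic2 F" "(f has_field_derivative a) (at z)" "(g has_field_derivative b) (at z)"
  shows "((\<lambda>z. F (f z, g z)) has_field_derivative
           (partial_x F (f z, g z) * a + partial_y F (f z, g z) * b)) (at z)"
proof -
  have "((\<lambda>z. (f z, g z)) has_derivative (\<lambda>v. (a * v, b * v))) (at z)"
    using assms(2,3) by (auto intro!: has_derivative_Pair simp: has_field_derivative_def)
  then have "((F \<circ> (\<lambda>z. (f z, g z))) has_derivative
      ((\<lambda>v. partial_x F (f z, g z) * fst v + partial_y F (f z, g z) * snd v) \<circ> (\<lambda>v. (a * v, b * v)))) (at z)"
    by (rule diff_chain_at) (rule holomorphic2_has_derivative[OF assms(1)])
  then show ?thesis
    unfolding has_field_derivative_def o_def fst_conv snd_conv
    by (rule has_derivative_eq_rhs) (simp add: fun_eq_iff distrib_right mult.assoc)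
qed

text \<open>
  The solution \<open>y = \<phi> x\<close> of \<open>K (x, y) = h\<close> over a whole domain \<open>D\<close>, as the fixed point of the Newton
  map \<open>y - (K (x, y) - h) / \<kappa> x\<close> with an approximate slope \<open>\<kappa>\<close>. If \<open>\<kappa>\<close> approximates
  \<open>\<partial>K/\<partial>y\<close> up to half the size of \<open>\<kappa>\<close>, the map contracts by the factor \<open>1/2\<close>. The variable slope is
  needed later: on an annulus the slope is proportional to \<open>x\<close>, and there the solution is wanted on the
  whole annulus and not only near a point.
\<close>

lemma implicit_function:
  fixes K :: "complex \<times> complex \<Rightarrow> complex" and \<kappa> :: "complex \<Rightarrow> complex"
  assumes K: "holomorphic2 K" and D: "open D" and r: "0 < r"
    and \<kappa>: "continuous_on D \<kappa>" "\<And>x. x \<in> D \<Longrightarrow> \<kappa> x \<noteq> 0"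
    and slope: "\<And>x y. x \<in> D \<Longrightarrow> y \<in> cball y0 r \<Longrightarrow> cmod (partial_y K (x, y) - \<kappa> x) \<le> cmod (\<kappa> x) / 2"
    and start: "\<And>x. x \<in> D \<Longrightarrow> cmod (K (x, y0) - h) \<le> cmod (\<kappa> x) * r / 2"
  obtains \<phi> where "\<phi> holomorphic_on D"
    and "\<And>x. x \<in> D \<Longrightarrow> \<phi> x \<in> cball y0 r" "\<And>x. x \<in> D \<Longrightarrow> K (x, \<phi> x) = h"
    and "\<And>x y. x \<in> D \<Longrightarrow> y \<in> cball y0 r \<Longrightarrow> K (x, y) = h \<Longrightarrow> y = \<phi> x"
proof -
  define N where "N x y = y - (K (x, y) - h) / \<kappa> x" for x y
  have contr: "cmod (N x y - N x y') \<le> 1/2 * cmod (y - y')"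
    if x: "x \<in> D" and y: "y \<in> cball y0 r" "y' \<in> cball y0 r" for x y y'
  proof (rule field_differentiable_bound[of "cball y0 r"])
    fix z assume z: "z \<in> cball y0 r"
    show "(N x has_field_derivative (1 - partial_y K (x, z) / \<kappa> x)) (at z within cball y0 r)"
      unfolding N_def using \<kappa>(2)[OF x]
      by (auto intro!: derivative_eq_intros holomorphic2_partial_y_field[OF K])
    have "1 - partial_y K (x, z) / \<kappa> x = - ((partial_y K (x, z) - \<kappa> x) / \<kappa> x)"
      using \<kappa>(2)[OF x] by (simp add: field_simps)
    then have "cmod (1 - partial_y K (x, z) / \<kappa> x) = cmod (partial_y K (x, z) - \<kappa> x) / cmod (\<kappa> x)"
      by (simp only: norm_minus_cancel norm_divide)
    also have "\<dots> \<le> 1/2"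
      using slope[OF x z] \<kappa>(2)[OF x] by (simp add: field_simps)
    finally show "cmod (1 - partial_y K (x, z) / \<kappa> x) \<le> 1/2" .
  qed (use y in auto)
  have fixpoint: "N x y = y \<longleftrightarrow> K (x, y) = h" if "x \<in> D" for x y
    using \<kappa>(2)[OF that] by (auto simp: N_def)
  have ex1: "\<exists>!y\<in>cball y0 r. N x y = y" if x: "x \<in> D" for x
  proof (rule Banach_fix[where c = "1/2"])
    show "N x ` cball y0 r \<subseteq> cball y0 r"
    proof
      fix z assume "z \<in> N x ` cball y0 r"
      then obtain y where y: "y \<in> cball y0 r" "z = N x y" by blast
      have "cmod (N x y - y0) \<le> cmod (N x y - N x y0) + cmod (N x y0 - y0)"
        using norm_triangle_ineq[of "N x y - N x y0" "N x y0 - y0"] by simp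
      also have "\<dots> \<le> 1/2 * r + r / 2"
      proof (rule add_mono)
        show "cmod (N x y - N x y0) \<le> 1/2 * r"
          using contr[OF x y(1), of y0] y(1) r by (simp add: dist_norm norm_minus_commute)
        have "cmod (N x y0 - y0) = cmod (K (x, y0) - h) / cmod (\<kappa> x)"
          by (simp add: N_def norm_divide)
        also have "\<dots> \<le> r / 2"
          using start[OF x] \<kappa>(2)[OF x] by (simp add: field_simps)
        finally show "cmod (N x y0 - y0) \<le> r / 2" .
      qed
      finally show "z \<in> cball y0 r"
        using y(2) by (simp add: dist_norm norm_minus_commute)
    qed
  qed (use r x contr in \<open>auto simp: dist_norm complete_eq_closed\<close>)
  define \<phi> where "\<phi> x = (THE y. y \<in> cball y0 r \<and> N x y = y)" for x
  have \<phi>: "\<phi> x \<in> cball y0 r \<and> N x (\<phi> x) = \<phi> x" if "x \<in> D" for x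
    unfolding \<phi>_def by (rule theI') (use ex1[OF that] in blast)
  have K\<phi>: "K (x, \<phi> x) = h" if "x \<in> D" for x
    using \<phi>[OF that] fixpoint[OF that] by blast
  have unique: "y = \<phi> x" if "x \<in> D" "y \<in> cball y0 r" "K (x, y) = h" for x y
    using ex1[OF that(1)] \<phi>[OF that(1)] fixpoint[OF that(1)] that(2,3) by blast
  have "(\<phi> has_field_derivative (- partial_x K (x0, \<phi> x0) / partial_y K (x0, \<phi> x0))) (at x0)" if x0: "x0 \<in> D" for x0
  proof -
    define y1 where "y1 = \<phi> x0"
    define a where "a = partial_x K (x0, y1)"
    define b where "b = partial_y K (x0, y1)"
    have y1: "y1 \<in> cball y0 r" using \<phi>[OF x0] by (simp add: y1_def)
    have "cmod (\<kappa> x0) \<le> cmod b + cmod (b - \<kappa> x0)"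
      by (metis norm_minus_commute norm_triangle_sub)
    then have b0: "b \<noteq> 0"
      using slope[OF x0 y1] \<kappa>(2)[OF x0] by (auto simp: b_def)
    have deriv: "(K has_derivative (\<lambda>v. a * fst v + b * snd v)) (at (x0, y1))"
      unfolding a_def b_def by (rule holomorphic2_has_derivative[OF K])
    define L where "L = 4 * (cmod a + 1) / cmod (\<kappa> x0)"
    have L: "0 \<le> L" by (simp add: L_def)
    \<comment> \<open>\<open>\<phi>\<close> is Lipschitz at \<open>x0\<close>: the contraction estimate compares \<open>\<phi> x\<close> with \<open>y1\<close>.\<close>
    have "\<forall>\<^sub>F x in nhds x0. x \<in> D"
      using D x0 by (simp add: eventually_nhds_in_open)
    moreover have "\<forall>\<^sub>F x in nhds x0. cmod (\<kappa> x0) / 2 < cmod (\<kappa> x)"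
    proof -
      have "isCont \<kappa> x0" using \<kappa>(1) D x0 continuous_on_eq_continuous_at by blast
      then have "((\<lambda>x. cmod (\<kappa> x)) \<longlongrightarrow> cmod (\<kappa> x0)) (nhds x0)"
        by (intro tendsto_norm) (simp add: continuous_at tendsto_at_iff_tendsto_nhds)
      then show ?thesis by (rule order_tendstoD) (use \<kappa>(2)[OF x0] in simp)
    qed
    moreover have "\<forall>\<^sub>F x in nhds x0. cmod (K (x, y1) - h) \<le> (cmod a + 1) * cmod (x - x0)"
    proof -
      obtain d where d: "d > 0" "\<And>q. norm (q - (x0, y1)) < d \<Longrightarrow>
          norm (K q - K (x0, y1) - (a * fst (q - (x0, y1)) + b * snd (q - (x0, y1)))) \<le> 1 * norm (q - (x0, y1))"
        using deriv unfolding has_derivative_at_alt by (meson zero_less_one)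
      have "cmod (K (x, y1) - h) \<le> (cmod a + 1) * cmod (x - x0)" if "dist x x0 < d" for x
      proof -
        have "norm (K (x, y1) - h - a * (x - x0)) \<le> cmod (x - x0)"
          using d(2)[of "(x, y1)"] that K\<phi>[OF x0] by (simp add: dist_norm y1_def norm_Pair)
        then have "norm (K (x, y1) - h) \<le> cmod (x - x0) + cmod (a * (x - x0))"
          by (smt (verit) norm_triangle_sub)
        then show ?thesis by (simp add: norm_mult distrib_right)
      qed
      then show ?thesis using d(1) by (auto simp: eventually_nhds_metric)
    qed
    ultimately have "\<forall>\<^sub>F x in nhds x0. x \<in> D \<and> cmod (\<phi> x - y1) \<le> L * cmod (x - x0)"
    proof eventually_elim
      case (elim x)
      have "cmod (\<phi> x - y1) \<le> cmod (N x (\<phi> x) - N x y1) + cmod (N x y1 - y1)"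
        using norm_triangle_ineq[of "N x (\<phi> x) - N x y1" "N x y1 - y1"] \<phi>[OF elim(1)] by simp
      also have "cmod (N x (\<phi> x) - N x y1) \<le> 1/2 * cmod (\<phi> x - y1)"
        using \<phi>[OF elim(1)] y1 elim(1) by (intro contr) auto
      finally have "cmod (\<phi> x - y1) \<le> 2 * cmod (N x y1 - y1)" by simp
      also have "\<dots> = 2 * (cmod (K (x, y1) - h) / cmod (\<kappa> x))"
        by (simp add: N_def norm_divide)
      also have "\<dots> \<le> 2 * (((cmod a + 1) * cmod (x - x0)) / (cmod (\<kappa> x0) / 2))"
        using elim \<kappa>(2)[OF x0] by (intro mult_left_mono frac_le) auto
      also have "\<dots> = L * cmod (x - x0)" by (simp add: L_def field_simps)
      finally show ?case using elim(1) by simp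
    qed
    then obtain d1 where d1: "d1 > 0" "\<And>x. dist x x0 < d1 \<Longrightarrow> x \<in> D \<and> cmod (\<phi> x - y1) \<le> L * cmod (x - x0)"
      by (auto simp: eventually_nhds_metric)
    have "(\<phi> has_derivative (*) (- a / b)) (at x0)"
      unfolding has_derivative_at_alt
    proof (intro conjI allI impI)
      fix e :: real assume "0 < e"
      define e' where "e' = e * cmod b / (1 + L)"
      have "e' > 0" using \<open>0 < e\<close> b0 L by (simp add: e'_def)
      then obtain d where d: "d > 0" "\<And>q. norm (q - (x0, y1)) < d \<Longrightarrow>
          norm (K q - K (x0, y1) - (a * fst (q - (x0, y1)) + b * snd (q - (x0, y1)))) \<le> e' * norm (q - (x0, y1))"
        using deriv unfolding has_derivative_at_alt by blast
      show "\<exists>d>0. \<forall>y. norm (y - x0) < d \<longrightarrow> norm (\<phi> y - \<phi> x0 - - a / b * (y - x0)) \<le> e * norm (y - x0)"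
      proof (intro exI[of _ "min d1 (d / (1 + L))"] conjI allI impI)
        show "0 < min d1 (d / (1 + L))" using d1 d L by simp
        fix x assume x: "norm (x - x0) < min d1 (d / (1 + L))"
        have xD: "x \<in> D" and lip: "cmod (\<phi> x - y1) \<le> L * cmod (x - x0)"
          using d1(2)[of x] x by (auto simp: dist_norm)
        have n: "norm ((x, \<phi> x) - (x0, y1)) \<le> (1 + L) * cmod (x - x0)"
          using norm_Pair_le[of "x - x0" "\<phi> x - y1"] lip by (simp add: algebra_simps)
        also have "\<dots> < d" using x L by (simp add: field_simps)
        finally have "norm (K (x, \<phi> x) - K (x0, y1) - (a * (x - x0) + b * (\<phi> x - y1))) \<le>
            e' * norm ((x, \<phi> x) - (x0, y1))"
          using d(2)[of "(x, \<phi> x)"] by simp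
        also have "\<dots> \<le> e' * ((1 + L) * cmod (x - x0))"
          using n \<open>e' > 0\<close> by (intro mult_left_mono) auto
        also have "\<dots> = cmod b * (e * cmod (x - x0))"
          using L by (simp add: e'_def)
        finally have "cmod (- (a * (x - x0) + b * (\<phi> x - y1))) \<le> cmod b * (e * cmod (x - x0))"
          using K\<phi>[OF xD] K\<phi>[OF x0] by (simp add: y1_def)
        then have "cmod (a * (x - x0) + b * (\<phi> x - y1)) \<le> cmod b * (e * cmod (x - x0))"
          by (simp only: norm_minus_cancel)
        moreover have "a * (x - x0) + b * (\<phi> x - y1) = b * (\<phi> x - \<phi> x0 - - a / b * (x - x0))"
          using b0 by (simp add: y1_def field_simps)
        ultimately show "norm (\<phi> x - \<phi> x0 - - a / b * (x - x0)) \<le> e * norm (x - x0)"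
          using b0 by (simp only: norm_mult) simp
      qed
    qed (rule bounded_linear_mult_right)
    then show ?thesis
      by (simp add: has_field_derivative_def a_def b_def y1_def)
  qed
  then have "\<phi> holomorphic_on D"
    unfolding holomorphic_on_def field_differentiable_def by (meson has_field_derivative_at_within)
  then show thesis
    using that \<phi> K\<phi> unique by blast
qed

section \<open>Primitives and periods on smooth level curves\<close>

definition tangent_vector :: "(complex \<times> complex \<Rightarrow> complex) \<Rightarrow> complex \<times> complex \<Rightarrow> complex \<times> complex \<Rightarrow> bool" where
  "tangent_vector H q v \<longleftrightarrow> partial_x H q * fst v + partial_y H q * snd v = 0"

text \<open>
  The slope at \<open>q0\<close> serves as \<open>\<kappa>\<close>, by continuity of \<open>K\<^sub>y\<close>. Over a disc in the \<open>x\<close>-plane the form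
  \<open>dx / K\<^sub>y\<close> on the graph is holomorphic and therefore has a primitive.
\<close>

lemma implicit_graph:
  assumes K: "holomorphic2 K" "holomorphic2 (partial_y K)" and q0: "K q0 = h" "partial_y K q0 \<noteq> 0"
  obtains V D \<phi> G where "open V" "q0 \<in> V" "open D" "\<phi> holomorphic_on D"
    "\<And>x. x \<in> D \<Longrightarrow> K (x, \<phi> x) = h"
    "\<And>q. q \<in> V \<Longrightarrow> K q = h \<Longrightarrow> fst q \<in> D \<and> snd q = \<phi> (fst q) \<and> partial_y K q \<noteq> 0"
    "\<And>x. x \<in> D \<Longrightarrow> (G has_field_derivative 1 / partial_y K (x, \<phi> x)) (at x)"
proof -
  define x0 y0 \<kappa> where "x0 = fst q0" and "y0 = snd q0" and "\<kappa> = partial_y K q0"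
  have q0_eq: "q0 = (x0, y0)" by (simp add: x0_def y0_def)
  have \<kappa>: "\<kappa> \<noteq> 0" using q0 by (simp add: \<kappa>_def)
  have "isCont (partial_y K) q0"
    by (rule has_derivative_continuous[OF holomorphic2_has_derivative[OF K(2)]])
  then obtain d where d: "d > 0" "\<And>q. dist q q0 < d \<Longrightarrow> dist (partial_y K q) \<kappa> < cmod \<kappa> / 2"
    unfolding continuous_at_eps_delta \<kappa>_def[symmetric] using \<kappa> by (metis half_gt_zero zero_less_norm_iff)
  define r where "r = d / 2"
  have r: "r > 0" using d by (simp add: r_def)
  have "isCont (\<lambda>x. K (x, y0)) x0"
    using holomorphic2_compose[OF K(1) DERIV_ident DERIV_const] DERIV_isCont by blast
  then obtain e where e: "e > 0" "\<And>x. dist x x0 < e \<Longrightarrow> dist (K (x, y0)) h < cmod \<kappa> * r / 2"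
    unfolding continuous_at_eps_delta using \<kappa> r q0(1) q0_eq
    by (metis half_gt_zero mult_pos_pos zero_less_norm_iff)
  define D where "D = ball x0 (min e r)"
  have slope: "cmod (partial_y K (x, y) - \<kappa>) \<le> cmod \<kappa> / 2" if "x \<in> D" "y \<in> cball y0 r" for x y
  proof -
    have "dist (x, y) q0 \<le> cmod (x - x0) + cmod (y - y0)"
      using norm_Pair_le[of "x - x0" "y - y0"] by (simp add: q0_eq dist_norm)
    also have "\<dots> < r + r"
      using that by (intro add_less_le_mono) (auto simp: D_def dist_norm norm_minus_commute)
    finally have "dist (partial_y K (x, y)) \<kappa> < cmod \<kappa> / 2"
      by (intro d(2)) (simp add: r_def)
    then show ?thesis by (simp add: dist_norm)
  qed
  obtain \<phi> where \<phi>: "\<phi> holomorphic_on D" "\<And>x. x \<in> D \<Longrightarrow> \<phi> x \<in> cball y0 r"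
    "\<And>x. x \<in> D \<Longrightarrow> K (x, \<phi> x) = h"
    "\<And>x y. x \<in> D \<Longrightarrow> y \<in> cball y0 r \<Longrightarrow> K (x, y) = h \<Longrightarrow> y = \<phi> x"
  proof (rule implicit_function[of K D r "\<lambda>_. \<kappa>" y0 h])
    show "cmod (K (x, y0) - h) \<le> cmod \<kappa> * r / 2" if "x \<in> D" for x
      using e(2)[of x] that by (simp add: D_def dist_norm norm_minus_commute)
  qed (use K r \<kappa> slope in \<open>auto simp: D_def\<close>)
  have nz: "partial_y K (x, y) \<noteq> 0" if "x \<in> D" "y \<in> cball y0 r" for x y
    using slope[OF that] \<kappa> by auto
  have "(\<lambda>x. 1 / partial_y K (x, \<phi> x)) holomorphic_on D"
  proof (intro holomorphic_on_divide holomorphic_on_const)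
    have "((\<lambda>x. partial_y K (x, \<phi> x)) has_field_derivative
        partial_x (partial_y K) (x, \<phi> x) * 1 + partial_y (partial_y K) (x, \<phi> x) * deriv \<phi> x) (at x)" if "x \<in> D" for x
      using \<phi>(1) that by (intro holomorphic2_compose K) (auto simp: D_def intro: holomorphic_derivI)
    moreover have "open D" by (simp add: D_def)
    ultimately show "(\<lambda>x. partial_y K (x, \<phi> x)) holomorphic_on D"
      unfolding holomorphic_on_open[OF \<open>open D\<close>] by blast
  qed (use nz \<phi>(2) in blast)
  then obtain G where G: "\<And>x. x \<in> D \<Longrightarrow> (G has_field_derivative 1 / partial_y K (x, \<phi> x)) (at x within D)"
    using holomorphic_convex_primitive'[of D] by (auto simp: D_def)
  show thesis
  proof
    show "open (D \<times> ball y0 r)" by (simp add: D_def open_Times)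
    show "q0 \<in> D \<times> ball y0 r" using r e by (simp add: q0_eq D_def)
    show "open D" by (simp add: D_def)
    show "\<phi> holomorphic_on D" by fact
    show "(G has_field_derivative 1 / partial_y K (x, \<phi> x)) (at x)" if "x \<in> D" for x
      using G[OF that] at_within_open[OF that] by (simp add: D_def)
    show "fst q \<in> D \<and> snd q = \<phi> (fst q) \<and> partial_y K q \<noteq> 0" if "q \<in> D \<times> ball y0 r" "K q = h" for q
      using that nz \<phi>(4) by (cases q) auto
  qed (use \<phi> in auto)
qed

lemma
  assumes "holomorphic2 F"
  shows holomorphic2_swap: "holomorphic2 (F \<circ> prod.swap)"
    and partial_y_swap: "partial_y (F \<circ> prod.swap) = partial_x F \<circ> prod.swap"
proof -
  have deriv: "((F \<circ> prod.swap) has_derivative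
      (\<lambda>v. partial_y F (prod.swap q) * fst v + partial_x F (prod.swap q) * snd v)) (at q)" for q
  proof -
    have "prod.swap = (\<lambda>q::complex \<times> complex. (snd q, fst q))"
      by (simp add: fun_eq_iff)
    moreover have "((\<lambda>q. (snd q, fst q)) has_derivative (\<lambda>q::complex \<times> complex. (snd q, fst q))) (at q)"
      by (intro has_derivative_Pair has_derivative_fst has_derivative_snd has_derivative_ident)
    ultimately have "(prod.swap has_derivative (\<lambda>q::complex \<times> complex. (snd q, fst q))) (at q)"
      by simp
    from diff_chain_at[OF this holomorphic2_has_derivative[OF assms]] show ?thesis
      by (rule has_derivative_eq_rhs) (simp add: fun_eq_iff)
  qed
  then show "holomorphic2 (F \<circ> prod.swap)"
    unfolding holomorphic2_def by blast
  show "partial_y (F \<circ> prod.swap) = partial_x F \<circ> prod.swap"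
    using has_derivative_pair_partials(2)[OF deriv] by (simp add: fun_eq_iff)
qed

locale smooth_level =
  fixes H :: "complex \<times> complex \<Rightarrow> complex" and h :: complex
  assumes holo: "holomorphic2 H" "holomorphic2 (partial_x H)" "holomorphic2 (partial_y H)"
    and smooth: "q \<in> level_curve H h \<Longrightarrow> partial_x H q \<noteq> 0 \<or> partial_y H q \<noteq> 0"
begin

abbreviation "S \<equiv> level_curve H h"

text \<open>
  A local parametrisation \<open>\<psi>\<close> of the curve by one of the coordinates, \<open>\<xi>\<close>, in which the form
  \<open>omega\<close> reads \<open>g(z) dz\<close> and has the primitive \<open>G\<close>. The coordinate can be taken to
  be \<open>x\<close> where \<open>H\<^sub>y \<noteq> 0\<close>, and \<open>y\<close> elsewhere.
\<close>

definition is_chart where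
  "is_chart q0 V D \<xi> \<psi> G g \<longleftrightarrow> open V \<and> q0 \<in> V \<and> open D \<and> (\<xi> = fst \<or> \<xi> = snd) \<and>
     (\<forall>z\<in>D. \<psi> z \<in> S \<and> (\<exists>a b. (\<psi> has_derivative (\<lambda>t. (a * t, b * t))) (at z))) \<and>
     (\<forall>q\<in>V \<inter> S. \<xi> q \<in> D \<and> \<psi> (\<xi> q) = q) \<and>
     (\<forall>z\<in>D. (G has_field_derivative g z) (at z)) \<and>
     (\<forall>q\<in>V \<inter> S. \<forall>v. tangent_vector H q v \<longrightarrow> omega H q v = g (\<xi> q) * \<xi> v)"

lemma is_chartD:
  assumes "is_chart q0 V D \<xi> \<psi> G g"
  shows "open V" "q0 \<in> V" "open D" "\<xi> = fst \<or> \<xi> = snd"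
    "\<And>z. z \<in> D \<Longrightarrow> \<psi> z \<in> S \<and> (\<exists>a b. (\<psi> has_derivative (\<lambda>t. (a * t, b * t))) (at z))"
    "\<And>q. q \<in> V \<inter> S \<Longrightarrow> \<xi> q \<in> D \<and> \<psi> (\<xi> q) = q"
    "\<And>z. z \<in> D \<Longrightarrow> (G has_field_derivative g z) (at z)"
    "\<And>q v. q \<in> V \<inter> S \<Longrightarrow> tangent_vector H q v \<Longrightarrow> omega H q v = g (\<xi> q) * \<xi> v"
  using assms unfolding is_chart_def by (simp_all del: split_paired_All)

lemma chart_exists:
  assumes q0: "q0 \<in> S"
  shows "\<exists>V D \<xi> \<psi> G g. is_chart q0 V D \<xi> \<psi> G g"
proof (cases "partial_y H q0 = 0")
  case False
  have "H q0 = h" using q0 by (simp add: level_curve_def)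
  from implicit_graph[OF holo(1,3) this False]
  obtain V D \<phi> G where *: "open V" "q0 \<in> V" "open D" "\<phi> holomorphic_on D"
    "\<And>x. x \<in> D \<Longrightarrow> H (x, \<phi> x) = h"
    "\<And>q. q \<in> V \<Longrightarrow> H q = h \<Longrightarrow> fst q \<in> D \<and> snd q = \<phi> (fst q) \<and> partial_y H q \<noteq> 0"
    "\<And>x. x \<in> D \<Longrightarrow> (G has_field_derivative 1 / partial_y H (x, \<phi> x)) (at x)"
    by metis
  have graph: "(x, \<phi> x) \<in> S \<and> (\<exists>a b. ((\<lambda>x. (x, \<phi> x)) has_derivative (\<lambda>t. (a * t, b * t))) (at x))" if "x \<in> D" for x
  proof -
    have "(\<phi> has_derivative (\<lambda>t. deriv \<phi> x * t)) (at x)"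
      using holomorphic_derivI[OF *(4,3) that] by (simp add: has_field_derivative_def)
    then have "((\<lambda>x. (x, \<phi> x)) has_derivative (\<lambda>t. (1 * t, deriv \<phi> x * t))) (at x)"
      by (auto intro!: derivative_eq_intros)
    then show ?thesis using *(5)[OF that] unfolding level_curve_def by blast
  qed
  have V: "fst q \<in> D \<and> (fst q, \<phi> (fst q)) = q \<and> partial_y H q \<noteq> 0" if "q \<in> V \<inter> S" for q
    using *(6)[of q] that by (auto simp: level_curve_def prod_eq_iff)
  then have form: "omega H q v = 1 / partial_y H (fst q, \<phi> (fst q)) * fst v" if "q \<in> V \<inter> S" for q v
    using that by (simp add: omega_def)
  have "is_chart q0 V D fst (\<lambda>x. (x, \<phi> x)) G (\<lambda>x. 1 / partial_y H (x, \<phi> x))"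
    unfolding is_chart_def
    by (intro conjI ballI allI impI) (use *(1-3,7) graph V form in blast)+
  then show ?thesis by blast
next
  case True
  define K where "K = H \<circ> prod.swap"
  have K: "holomorphic2 K" "holomorphic2 (partial_y K)" and K_y: "partial_y K = partial_x H \<circ> prod.swap"
    unfolding K_def partial_y_swap[OF holo(1)] by (intro holomorphic2_swap holo refl)+
  have "K (prod.swap q0) = h" "partial_y K (prod.swap q0) \<noteq> 0"
    using smooth[OF q0] True q0 by (auto simp: K_y) (simp add: K_def level_curve_def)
  from implicit_graph[OF K this]
  obtain V D \<phi> G where *: "open V" "prod.swap q0 \<in> V" "open D" "\<phi> holomorphic_on D"
    "\<And>x. x \<in> D \<Longrightarrow> K (x, \<phi> x) = h"
    "\<And>q. q \<in> V \<Longrightarrow> K q = h \<Longrightarrow> fst q \<in> D \<and> snd q = \<phi> (fst q) \<and> partial_y K q \<noteq> 0"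
    "\<And>x. x \<in> D \<Longrightarrow> (G has_field_derivative 1 / partial_y K (x, \<phi> x)) (at x)"
    by metis
  have graph: "(\<phi> x, x) \<in> S \<and> (\<exists>a b. ((\<lambda>x. (\<phi> x, x)) has_derivative (\<lambda>t. (a * t, b * t))) (at x))" if "x \<in> D" for x
  proof -
    have "(\<phi> has_derivative (\<lambda>t. deriv \<phi> x * t)) (at x)"
      using holomorphic_derivI[OF *(4,3) that] by (simp add: has_field_derivative_def)
    then have "((\<lambda>x. (\<phi> x, x)) has_derivative (\<lambda>t. (deriv \<phi> x * t, 1 * t))) (at x)"
      by (auto intro!: derivative_eq_intros)
    moreover have "H (\<phi> x, x) = h" using *(5)[OF that] by (simp add: K_def)
    ultimately show ?thesis unfolding level_curve_def by blast
  qed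
  have V: "snd q \<in> D \<and> (\<phi> (snd q), snd q) = q \<and> partial_x H q \<noteq> 0" if "q \<in> prod.swap -` V \<inter> S" for q
    using *(6)[of "prod.swap q"] that by (auto simp: K_def K_y[unfolded K_def] level_curve_def prod_eq_iff)
  have form: "omega H q v = - (1 / partial_x H (\<phi> (snd q), snd q)) * snd v"
    if "q \<in> prod.swap -` V \<inter> S" "tangent_vector H q v" for q v
  proof -
    have "fst v / partial_y H q = - snd v / partial_x H q" if "partial_y H q \<noteq> 0"
      using \<open>tangent_vector H q v\<close> V[OF \<open>q \<in> _\<close>] that
      by (simp add: tangent_vector_def field_simps add_eq_0_iff)
    then show ?thesis using V[OF that(1)] by (auto simp: omega_def)
  qed
  have "open (prod.swap -` V)"
    using \<open>open V\<close> by (intro open_vimage continuous_on_swap)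
  moreover have "q0 \<in> prod.swap -` V" using *(2) by simp
  moreover have "((\<lambda>x. - G x) has_field_derivative - (1 / partial_x H (\<phi> x, x))) (at x)" if "x \<in> D" for x
    using *(7)[OF that] by (auto simp: K_y intro!: derivative_eq_intros)
  ultimately have "is_chart q0 (prod.swap -` V) D snd (\<lambda>x. (\<phi> x, x)) (\<lambda>x. - G x) (\<lambda>x. - (1 / partial_x H (\<phi> x, x)))"
    unfolding is_chart_def
    by (intro conjI ballI allI impI) (use *(3) graph V form in blast)+
  then show ?thesis by blast
qed

text \<open>
  The function is defined and differentiated on the ambient space, although only its values on the
  curve matter, so that the chain rule in \<open>\<complex>\<^sup>2\<close> applies to paths that stay on the curve.
\<close>

definition primitive_on :: "(complex \<times> complex) set \<Rightarrow> (complex \<times> complex \<Rightarrow> complex) \<Rightarrow> bool" where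
  "primitive_on W F \<longleftrightarrow> (\<forall>q\<in>W. \<exists>F'. (F has_derivative F') (at q) \<and>
     (\<forall>v. tangent_vector H q v \<longrightarrow> F' v = omega H q v))"

lemma local_primitive:
  assumes q0: "q0 \<in> S"
  obtains V F where "open V" "q0 \<in> V" "primitive_on (V \<inter> S) F"
proof -
  obtain V D \<xi> \<psi> G g where "is_chart q0 V D \<xi> \<psi> G g"
    using chart_exists[OF q0] by blast
  note c = is_chartD[OF this]
  have "(\<xi> has_derivative \<xi>) (at q)" for q
    using c(4) bounded_linear_imp_has_derivative[OF bounded_linear_fst]
      bounded_linear_imp_has_derivative[OF bounded_linear_snd] by blast
  then have "((G \<circ> \<xi>) has_derivative ((*) (g (\<xi> q)) \<circ> \<xi>)) (at q)" if "q \<in> V \<inter> S" for q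
    using c(6)[OF that] c(7)[of "\<xi> q"]
    by (intro diff_chain_at) (simp_all add: has_field_derivative_def)
  then have "primitive_on (V \<inter> S) (G \<circ> \<xi>)"
    unfolding primitive_on_def using c(8) by fastforce
  then show thesis using that c by blast
qed

text \<open>
  In a chart around \<open>q0\<close> the difference of the primitives has derivative zero, because both
  derivatives agree with \<open>omega\<close> on tangent vectors. Connectedness of the chart domain then gives
  the claim near \<open>q0\<close> on the curve.
\<close>

lemma primitives_differ_locally_constant:
  assumes F: "primitive_on U F1" "primitive_on U F2" and U: "openin (top_of_set S) U" and q0: "q0 \<in> U"
  shows "\<forall>\<^sub>F q in at q0 within S. F1 q - F2 q = F1 q0 - F2 q0"
proof -
  obtain U' where U': "open U'" "U = S \<inter> U'" using U by (auto simp: openin_open)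
  have "q0 \<in> S" using U' q0 by auto
  obtain V D \<xi> \<psi> G g where "is_chart q0 V D \<xi> \<psi> G g"
    using chart_exists[OF \<open>q0 \<in> S\<close>] by blast
  note c = is_chartD[OF this]
  let ?z0 = "\<xi> q0"
  have z0: "?z0 \<in> D" "\<psi> ?z0 = q0" using c(6)[of q0] c(2) \<open>q0 \<in> S\<close> by auto
  have cont: "continuous_on D \<psi>"
    by (meson c(5) continuous_at_imp_continuous_on has_derivative_continuous)
  have "open (D \<inter> \<psi> -` U')"
    using continuous_open_preimage[OF cont c(3) U'(1)] .
  moreover have "?z0 \<in> D \<inter> \<psi> -` U'" using z0 q0 U' by auto
  ultimately obtain e where e: "e > 0" "ball ?z0 e \<subseteq> D \<inter> \<psi> -` U'"
    by (meson open_contains_ball)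
  have const: "F1 (\<psi> z) - F2 (\<psi> z) = F1 q0 - F2 q0" if "z \<in> ball ?z0 e" for z
  proof -
    have "((\<lambda>z. F1 (\<psi> z) - F2 (\<psi> z)) has_field_derivative 0) (at z within ball ?z0 e)" if z: "z \<in> ball ?z0 e" for z
    proof -
      have zD: "z \<in> D" and "\<psi> z \<in> U" using z e c(5) U' by auto
      obtain a b where ab: "(\<psi> has_derivative (\<lambda>t. (a * t, b * t))) (at z)" using c(5)[OF zD] by blast
      have "((\<lambda>z. H (\<psi> z)) has_derivative (\<lambda>t. partial_x H (\<psi> z) * (a * t) + partial_y H (\<psi> z) * (b * t))) (at z)"
        using has_derivative_compose[OF ab holomorphic2_has_derivative[OF holo(1)]] by simp
      moreover have "((\<lambda>z. H (\<psi> z)) has_derivative (\<lambda>t. 0)) (at z)"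
        by (rule has_derivative_transform_within_open[where s = D and f = "\<lambda>_. h"])
          (use c(3,5) zD in \<open>auto simp: level_curve_def\<close>)
      ultimately have "(\<lambda>t. partial_x H (\<psi> z) * (a * t) + partial_y H (\<psi> z) * (b * t)) = (\<lambda>t. 0)"
        by (rule has_derivative_unique)
      then have tan: "tangent_vector H (\<psi> z) (a * t, b * t)" for t
        by (simp add: tangent_vector_def fun_eq_iff)
      obtain F1' where 1: "(F1 has_derivative F1') (at (\<psi> z))"
          "\<And>v. tangent_vector H (\<psi> z) v \<Longrightarrow> F1' v = omega H (\<psi> z) v"
        using F(1) \<open>\<psi> z \<in> U\<close> unfolding primitive_on_def by blast
      obtain F2' where 2: "(F2 has_derivative F2') (at (\<psi> z))"
          "\<And>v. tangent_vector H (\<psi> z) v \<Longrightarrow> F2' v = omega H (\<psi> z) v"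
        using F(2) \<open>\<psi> z \<in> U\<close> unfolding primitive_on_def by blast
      have "((\<lambda>z. F1 (\<psi> z) - F2 (\<psi> z)) has_derivative (\<lambda>t. F1' (a * t, b * t) - F2' (a * t, b * t))) (at z)"
        by (intro has_derivative_diff has_derivative_compose[OF ab] 1 2)
      then show ?thesis
        using 1(2)[OF tan] 2(2)[OF tan]
        by (simp add: has_field_derivative_def lambda_zero has_derivative_at_withinI)
    qed
    then have "\<exists>k. \<forall>z\<in>ball ?z0 e. F1 (\<psi> z) - F2 (\<psi> z) = k"
      by (intro has_field_derivative_zero_constant convex_ball)
    then obtain k where k: "\<forall>z\<in>ball ?z0 e. F1 (\<psi> z) - F2 (\<psi> z) = k" by blast
    have "?z0 \<in> ball ?z0 e" using e(1) by simp
    then show ?thesis using k[rule_format, of ?z0] k[rule_format, OF that] z0(2) by simp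
  qed
  have "isCont \<xi> q0" using c(4) by (auto intro!: continuous_intros)
  then have "\<forall>\<^sub>F q in at q0 within S. \<xi> q \<in> ball ?z0 e"
    using e(1) by (metis centre_in_ball continuous_at_imp_continuous_at_within continuous_within open_ball topological_tendstoD)
  moreover have "\<forall>\<^sub>F q in at q0 within S. q \<in> V \<inter> S"
    using eventually_at_topological c(1,2) by auto
  ultimately show ?thesis
    by eventually_elim (use const c(6) in metis)
qed

lemma path_tangent:
  assumes g: "C1_loop_in S g"
  obtains E where "finite E" "\<And>t. t \<in> {0..1} - E \<Longrightarrow> t \<in> {0<..<1} \<and> tangent_vector H (g t) (vector_derivative g (at t within {0..1})) \<and>
     (g has_vector_derivative vector_derivative g (at t within {0..1})) (at t)"
proof -
  obtain E0 where E0: "finite E0" "g C1_differentiable_on ({0..1} - E0)"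
    using g unfolding C1_loop_in_def valid_path_def piecewise_C1_differentiable_on_def by blast
  show thesis
  proof
    show "finite (E0 \<union> {0, 1})" using E0 by simp
    fix t :: real assume t: "t \<in> {0..1} - (E0 \<union> {0, 1})"
    then obtain v where v: "(g has_vector_derivative v) (at t)"
      using E0(2) unfolding C1_differentiable_on_def by blast
    then have vd: "vector_derivative g (at t within {0..1}) = v"
      using t by (intro vector_derivative_at_within_ivl) auto
    have "((\<lambda>t. H (g t)) has_derivative (\<lambda>s. partial_x H (g t) * fst (s *\<^sub>R v) + partial_y H (g t) * snd (s *\<^sub>R v))) (at t)"
      by (rule has_derivative_compose[OF v[unfolded has_vector_derivative_def] holomorphic2_has_derivative[OF holo(1)]])
    moreover have "((\<lambda>t. H (g t)) has_derivative (\<lambda>t. 0)) (at t)"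
    proof (rule has_derivative_transform_within_open[where s = "{0<..<1}" and f = "\<lambda>_. h"])
      show "h = H (g s)" if "s \<in> {0<..<1}" for s
      proof -
        have "g s \<in> path_image g" using that by (simp add: path_image_def)
        then have "g s \<in> S" using g by (auto simp: C1_loop_in_def)
        then show ?thesis by (simp add: level_curve_def)
      qed
    qed (use t in auto)
    ultimately have "(\<lambda>s. partial_x H (g t) * fst (s *\<^sub>R v) + partial_y H (g t) * snd (s *\<^sub>R v)) = (\<lambda>t. 0)"
      by (rule has_derivative_unique)
    from fun_cong[OF this, of 1] have "tangent_vector H (g t) v"
      by (simp add: tangent_vector_def)
    then show "t \<in> {0<..<1} \<and> tangent_vector H (g t) (vector_derivative g (at t within {0..1})) \<and>
       (g has_vector_derivative vector_derivative g (at t within {0..1})) (at t)"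
      using t v vd by auto
  qed
qed

text \<open>
  The indefinite integral along a path and the values of a primitive along it have the same
  derivative outside a finite set, and connected subsets of the interval contain the segments between
  their points.
\<close>

lemma integral_along_primitive:
  assumes g: "C1_loop_in S g" and I: "has_omega_integral H g I"
    and F: "primitive_on W F" and T: "connected T" "T \<subseteq> {0..1}" "g ` T \<subseteq> W" "s \<in> T" "t \<in> T"
  defines "f \<equiv> \<lambda>t. integral {0..t} (\<lambda>t. omega H (g t) (vector_derivative g (at t within {0..1})))"
  shows "f t - f s = F (g t) - F (g s)"
proof -
  let ?w = "\<lambda>t. omega H (g t) (vector_derivative g (at t within {0..1}))"
  obtain E where E: "finite E" "\<And>t. t \<in> {0..1} - E \<Longrightarrow> t \<in> {0<..<1} \<and> tangent_vector H (g t) (vector_derivative g (at t within {0..1})) \<and>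
     (g has_vector_derivative vector_derivative g (at t within {0..1})) (at t)"
    using path_tangent[OF g] by metis
  have int: "?w integrable_on {0..1}" using I by (auto simp: has_omega_integral_def)
  have main: "f b - f a = F (g b) - F (g a)" if ab: "a \<in> T" "b \<in> T" "a \<le> b" for a b
  proof -
    have sub: "{a..b} \<subseteq> T" using T(1) ab by (simp add: connected_contains_Icc)
    have "(?w has_integral ((F \<circ> g) b - (F \<circ> g) a)) {a..b}"
    proof (rule fundamental_theorem_of_calculus_interior_strong[OF E(1) ab(3)])
      fix u assume u: "u \<in> {a<..<b} - E"
      then have uT: "u \<in> T" using sub by auto
      obtain F' where F': "(F has_derivative F') (at (g u))"
          "\<And>v. tangent_vector H (g u) v \<Longrightarrow> F' v = omega H (g u) v"
        using F uT T(3) unfolding primitive_on_def by blast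
      have d: "tangent_vector H (g u) (vector_derivative g (at u within {0..1}))"
         "(g has_vector_derivative vector_derivative g (at u within {0..1})) (at u)"
        using E(2)[of u] u uT T(2) by auto
      have "((F \<circ> g) has_vector_derivative F' (vector_derivative g (at u within {0..1}))) (at u)"
        by (rule vector_derivative_diff_chain_within[OF d(2) has_derivative_at_withinI[OF F'(1)]])
      then show "((F \<circ> g) has_vector_derivative ?w u) (at u)"
        by (simp only: F'(2)[OF d(1)])
    next
      have "continuous_on W F"
        using F unfolding primitive_on_def
        by (meson continuous_at_imp_continuous_on has_derivative_continuous)
      moreover have "continuous_on {0..1} g"
        using g by (simp add: C1_loop_in_def valid_path_def piecewise_C1_differentiable_on_def)
      ultimately show "continuous_on {a..b} (F \<circ> g)"
        using sub T by (intro continuous_on_compose) (auto elim!: continuous_on_subset)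
    qed
    then have "integral {a..b} ?w = F (g b) - F (g a)"
      by (simp add: integral_unique)
    moreover have "f a + integral {a..b} ?w = f b"
      unfolding f_def
    proof (rule Henstock_Kurzweil_Integration.integral_combine)
      show "?w integrable_on {0..b}"
        using integrable_subinterval_real[OF int, of 0 b] ab T(2) by auto
    qed (use ab T(2) in auto)
    ultimately show ?thesis by (metis add_diff_cancel_left')
  qed
  show ?thesis
  proof (cases "s \<le> t")
    case False
    then have "f s - f t = F (g s) - F (g t)" using main[of t s] T(4,5) by simp
    then show ?thesis by (metis minus_diff_eq)
  qed (use main T(4,5) in simp)
qed

definition chart_cover :: "(complex \<times> complex) set set" where
  "chart_cover = {U. openin (top_of_set S) U \<and> (\<exists>F. primitive_on U F)}"

definition chosen_primitive :: "(complex \<times> complex) set \<Rightarrow> complex \<times> complex \<Rightarrow> complex" where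
  "chosen_primitive U = (SOME F. primitive_on U F)"

lemma chosen_primitive: "U \<in> chart_cover \<Longrightarrow> primitive_on U (chosen_primitive U)"
  using someI_ex[of "primitive_on U"] unfolding chart_cover_def chosen_primitive_def by blast

lemma local_primitives: "local_primitives (top_of_set S) chart_cover chosen_primitive"
proof
  show "topspace (top_of_set S) \<subseteq> \<Union>chart_cover"
  proof
    fix q assume "q \<in> topspace (top_of_set S)"
    then have "q \<in> S" by simp
    then obtain V F where "open V" "q \<in> V" "primitive_on (V \<inter> S) F" using local_primitive by blast
    then have "V \<inter> S \<in> chart_cover" by (auto simp: chart_cover_def openin_open)
    then show "q \<in> \<Union>chart_cover" using \<open>q \<in> V\<close> \<open>q \<in> S\<close> by blast
  qed
next
  fix U V T a b
  assume UV: "U \<in> chart_cover" "V \<in> chart_cover" and T: "connectedin (top_of_set S) T" "T \<subseteq> U" "T \<subseteq> V"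
    and ab: "a \<in> T" "b \<in> T"
  let ?F = "chosen_primitive"
  have UV': "openin (top_of_set S) (U \<inter> V)" using UV by (auto simp: chart_cover_def)
  have prim: "primitive_on (U \<inter> V) (?F U)" "primitive_on (U \<inter> V) (?F V)"
    using chosen_primitive[OF UV(1)] chosen_primitive[OF UV(2)] by (auto simp: primitive_on_def)
  have conn: "connected T" "T \<subseteq> S"
    using T(1) connectedin_subset_topspace[OF T(1)] by (auto simp: connectedin_subtopology)
  have "?F U a - ?F V a = ?F U b - ?F V b"
  proof (rule connected_local_const[OF conn(1) ab], intro ballI)
    fix c assume "c \<in> T"
    then have "\<forall>\<^sub>F q in at c within S. ?F U q - ?F V q = ?F U c - ?F V c"
      using T by (intro primitives_differ_locally_constant[OF prim UV']) auto
    then show "\<forall>\<^sub>F q in at c within T. ?F U c - ?F V c = ?F U q - ?F V q"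
      using conn(2) by (auto simp: eventually_at elim!: ex_forward)
  qed
  then show "?F U b - ?F U a = ?F V b - ?F V a" by (simp add: algebra_simps)
qed (simp add: chart_cover_def)

text \<open>
  The relatively open sets on which \<open>omega\<close> has a primitive are the cover to which
  \<open>homologous_paths_increment\<close> is applied; the primitive along a loop is the indefinite integral.
\<close>

lemma homologous_loops_same_integral:
  assumes "C1_loop_in S g1" "C1_loop_in S g2" "loop_class S g1 = loop_class S g2"
    and "has_omega_integral H g1 I1" "has_omega_integral H g2 I2"
  shows "I1 = I2"
proof -
  interpret local_primitives "top_of_set S" chart_cover chosen_primitive
    by (rule local_primitives)
  define f where "f g t = integral {0..t} (\<lambda>t. omega H (g t) (vector_derivative g (at t within {0..1})))" for g and t :: real
  have cont: "continuous_map (top_of_set {0..1}) (top_of_set S) g" if "C1_loop_in S g" for g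
    using that by (auto simp: C1_loop_in_def valid_path_def piecewise_C1_differentiable_on_def path_image_def)
  have step: "f g t - f g s = chosen_primitive U (g t) - chosen_primitive U (g s)"
    if "C1_loop_in S g" "has_omega_integral H g I" "U \<in> chart_cover" "connected T" "T \<subseteq> {0..1}" "g ` T \<subseteq> U" "s \<in> T" "t \<in> T"
    for g I U T s t
    using integral_along_primitive[OF that(1,2) chosen_primitive[OF that(3)] that(4-8)] by (simp add: f_def)
  have "f g1 1 - f g1 0 = f g2 1 - f g2 0"
    by (rule homologous_paths_increment)
      (use assms cont step in \<open>auto simp: loop_class_def homologous_rel_set_eq\<close>)
  then show ?thesis
    using assms(4,5) by (simp add: f_def has_omega_integral_def integral_unique)
qed

text \<open>
  Any representing loop computes the period. So the limit of the period can be found from the loops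
  of size \<open>sqrt \<bar>h\<bar>\<close> that the orientation condition provides.
\<close>

lemma period_eq:
  assumes "C1_loop_in S g" "loop_class S g = c" "has_omega_integral H g I"
  shows "period H h c = I"
  unfolding period_def
proof (rule the_equality)
  show "\<exists>g. C1_loop_in S g \<and> loop_class S g = c \<and> has_omega_integral H g I"
    using assms by blast
  show "J = I" if "\<exists>g. C1_loop_in S g \<and> loop_class S g = c \<and> has_omega_integral H g J" for J
  proof -
    from that obtain g' where "C1_loop_in S g'" "loop_class S g' = c" "has_omega_integral H g' J" by blast
    then show ?thesis using homologous_loops_same_integral[of g' g J I] assms by simp
  qed
qed

end

section \<open>A loop around a saddle\<close>

lemma holomorphic2_partial_x_field:
  assumes "holomorphic2 F"
  shows "((\<lambda>x. F (x, y)) has_field_derivative partial_x F (x, y)) (at x within S)"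
  using holomorphic2_compose[OF assms DERIV_ident DERIV_const, of y x]
  by (simp add: has_field_derivative_at_within)

text \<open>
  In the punctured plane, loops of equal winding number are homotopic; the radial retraction onto
  the closed annulus moves that homotopy into the annulus and fixes both loops.
\<close>

lemma homotopic_to_circle_in_annulus:
  fixes \<Gamma> :: "real \<Rightarrow> complex"
  assumes "path \<Gamma>" "pathfinish \<Gamma> = pathstart \<Gamma>" "winding_number \<Gamma> 0 = 1"
    and a: "0 < a" "a \<le> b" and \<Gamma>: "\<And>t. t \<in> {0..1} \<Longrightarrow> cmod (\<Gamma> t) \<in> {a..b}"
  shows "homotopic_loops {z. cmod z \<in> {a..b}} \<Gamma> (circlepath 0 b)"
proof -
  define \<rho> where "\<rho> z = of_real (max a (min b (cmod z)) / cmod z) * z" for z :: complex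
  have \<rho>_id: "\<rho> z = z" if "cmod z \<in> {a..b}" for z
    using that a by (auto simp: \<rho>_def min_absorb2 max_absorb2)
  have "0 \<notin> path_image \<Gamma>"
    using \<Gamma> a by (fastforce simp: path_image_def)
  moreover have "0 \<notin> path_image (circlepath 0 b)" "winding_number (circlepath 0 b) 0 = 1"
    using a by (auto simp: winding_number_circlepath)
  ultimately have "homotopic_loops (-{0}) \<Gamma> (circlepath 0 b)"
    using assms(1-3) by (subst winding_number_homotopic_loops_eq[symmetric]) auto
  moreover have "continuous_on (-{0}) \<rho>"
    unfolding \<rho>_def by (intro continuous_intros) auto
  moreover have "\<rho> \<in> -{0} \<rightarrow> {z. cmod z \<in> {a..b}}"
    using a by (auto simp: \<rho>_def norm_mult norm_divide)
  ultimately have h: "homotopic_loops {z. cmod z \<in> {a..b}} (\<rho> \<circ> \<Gamma>) (\<rho> \<circ> circlepath 0 b)"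
    by (rule homotopic_loops_continuous_image)
  have "homotopic_loops {z. cmod z \<in> {a..b}} \<Gamma> (\<rho> \<circ> \<Gamma>)"
    using assms(1,2) \<Gamma> \<rho>_id by (intro homotopic_loops_eq) (auto simp: path_image_def)
  moreover have "homotopic_loops {z. cmod z \<in> {a..b}} (circlepath 0 b) (\<rho> \<circ> circlepath 0 b)"
  proof (rule homotopic_loops_eq)
    have "cmod (circlepath 0 b t) = b" for t
      using a by (simp add: circlepath norm_mult)
    then show "path_image (circlepath 0 b) \<subseteq> {z. cmod z \<in> {a..b}}"
        "circlepath 0 b t = (\<rho> \<circ> circlepath 0 b) t" for t
      using a \<rho>_id by (auto simp: path_image_def)
  qed (auto simp: valid_path_imp_path)
  ultimately show ?thesis
    using h by (meson homotopic_loops_sym homotopic_loops_trans)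
qed

lemma derivative_linear_bound:
  fixes F :: "'a::real_normed_vector \<Rightarrow> 'b::real_normed_vector"
  assumes "(F has_derivative F') (at 0)" "F 0 = 0" "\<epsilon> > 0"
  obtains d where "d > 0" "\<And>q. norm q < d \<Longrightarrow> norm (F q - F' q) \<le> \<epsilon> * norm q"
  using assms unfolding has_derivative_at_alt by (metis diff_zero)

text \<open>
  The analytic core. Let the slope \<open>\<partial>K/\<partial>\<eta>\<close> be \<open>\<nu> \<zeta>\<close> to first order at the critical point \<open>0\<close>,
  and put \<open>\<rho> = sqrt \<bar>h\<bar>\<close>. A loop on \<open>K = h\<close> of size \<open>O(\<rho>)\<close> keeps \<open>\<bar>\<zeta>\<bar>\<close> between two
  multiples of \<open>\<rho>\<close>. Over the annulus between them the curve is a graph \<open>\<eta> = \<phi> \<zeta>\<close>, so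
  the integrand becomes the holomorphic form \<open>f(\<zeta>) d\<zeta>\<close> with \<open>f = 1 / (\<partial>K/\<partial>\<eta>)\<close>, and Cauchy's theorem
  replaces the loop by a circle of radius \<open>C \<rho>\<close>. There \<open>f = 1 / (\<nu> \<zeta>) + o(1/\<rho>)\<close>, and the error
  term integrates to \<open>o(1)\<close>. The circle cannot be avoided: a \<open>valid_path\<close> is \<open>C\<^sup>1\<close>
  only off finitely many parameters and may have infinite length, so a bound for the integrand along
  the given loop says nothing about the integral.
\<close>

lemma annulus_integral:
  fixes K :: "complex \<times> complex \<Rightarrow> complex"
  assumes K: "holomorphic2 K" "holomorphic2 (partial_x K)" "holomorphic2 (partial_y K)"
    and zero: "K 0 = 0" "partial_x K 0 = 0" "partial_y K 0 = 0"
    and \<nu>: "(partial_y K has_derivative (\<lambda>v. \<nu> * fst v)) (at 0)" "\<nu> \<noteq> 0"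
    and C: "1 \<le> C" and e: "0 < e"
  shows "\<forall>\<^sub>F h in at 0. \<forall>\<Gamma> \<eta>. valid_path \<Gamma> \<longrightarrow> pathfinish \<Gamma> = pathstart \<Gamma> \<longrightarrow> winding_number \<Gamma> 0 = 1 \<longrightarrow>
    (\<forall>t\<in>{0..1}. cmod (\<Gamma> t) \<le> C * sqrt (cmod h) \<and> cmod (\<eta> t) \<le> C * sqrt (cmod h) \<and> K (\<Gamma> t, \<eta> t) = h) \<longrightarrow>
    (\<forall>t\<in>{0..1}. partial_y K (\<Gamma> t, \<eta> t) \<noteq> 0) \<and>
    (\<exists>I. ((\<lambda>t. vector_derivative \<Gamma> (at t within {0..1}) / partial_y K (\<Gamma> t, \<eta> t)) has_integral I) {0..1} \<and>
         cmod (I - 2 * of_real pi * \<i> / \<nu>) \<le> e)"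
proof -
  obtain a b where "(partial_x K has_derivative (\<lambda>v. a * fst v + b * snd v)) (at 0)"
    using K(2) unfolding holomorphic2_def by blast
  from derivative_linear_bound[OF this zero(2) zero_less_one]
  obtain d0 where d0: "d0 > 0" "\<And>q. norm q < d0 \<Longrightarrow> norm (partial_x K q - (a * fst q + b * snd q)) \<le> 1 * norm q"
    by blast
  define M where "M = cmod a + cmod b + 1"
  have M: "1 \<le> M" by (simp add: M_def)
  have K1: "cmod (partial_x K (x, y)) \<le> M * (cmod x + cmod y)" if "cmod x + cmod y < d0" for x y
  proof -
    have n: "norm (x, y) \<le> cmod x + cmod y" by (rule norm_Pair_le)
    have "cmod (partial_x K (x, y) - (a * x + b * y)) \<le> cmod x + cmod y"
      using d0(2)[of "(x, y)"] n that by simp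
    moreover have "cmod (a * x + b * y) \<le> cmod a * cmod x + cmod b * cmod y"
      by (metis norm_mult norm_triangle_ineq)
    moreover have "cmod (partial_x K (x, y)) \<le> cmod (partial_x K (x, y) - (a * x + b * y)) + cmod (a * x + b * y)"
      by (metis add.commute norm_triangle_sub)
    ultimately have "cmod (partial_x K (x, y)) \<le> cmod x + cmod y + (cmod a * cmod x + cmod b * cmod y)"
      by linarith
    also have "\<dots> \<le> M * (cmod x + cmod y)"
      by (simp add: M_def algebra_simps)
    finally show ?thesis .
  qed
  \<comment> \<open>The loop will satisfy \<open>\<bar>\<zeta>\<bar> \<ge> 2 c \<rho>\<close>; the factor 2 leaves room for an open annulus around it.\<close>
  define c where "c = 1 / (8 * M * C)"
  have c: "0 < c" "2 * c \<le> C"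
  proof -
    have "1 \<le> 8 * M * C" using M C mult_mono[of 1 M 1 C] by simp
    then show "0 < c" "2 * c \<le> C" using C M mult_mono[of 1 M 1 C] unfolding c_def by (auto simp: field_simps intro: order_trans)
  qed
  \<comment> \<open>\<open>B \<rho>\<close> is the radius of the discs in which \<open>\<eta>\<close> is solved for: large enough for \<open>\<eta>\<close> along
    the loop, and for the Newton map that starts at \<open>\<eta> = 0\<close>.\<close>
  define B where "B = max C (2 * (1 + 4 * M * C\<^sup>2) / (cmod \<nu> * c))"
  define R where "R = 2 * C + B"
  have B: "C \<le> B" "2 * (1 + 4 * M * C\<^sup>2) \<le> B * (cmod \<nu> * c)"
  proof -
    have "2 * (1 + 4 * M * C\<^sup>2) / (cmod \<nu> * c) \<le> B" by (simp add: B_def)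
    then show "2 * (1 + 4 * M * C\<^sup>2) \<le> B * (cmod \<nu> * c)"
      using c \<nu>(2) by (simp add: pos_divide_le_eq)
  qed (simp add: B_def)
  have R: "0 < R" using B C by (simp add: R_def)
  \<comment> \<open>The three bounds on \<open>\<epsilon>\<close> keep the loop away from \<open>\<zeta> = 0\<close>, make the Newton map contract, and make the
    final error at most \<open>e\<close>.\<close>
  define \<epsilon> where "\<epsilon> = min (1 / (2 * C\<^sup>2)) (min (cmod \<nu> * c / (2 * R)) (e * (cmod \<nu>)\<^sup>2 * C / (4 * pi * R)))"
  have \<epsilon>: "0 < \<epsilon>" "\<epsilon> * C\<^sup>2 \<le> 1 / 2" "\<epsilon> * R \<le> cmod \<nu> * c / 2" "4 * pi * \<epsilon> * R \<le> e * (cmod \<nu>)\<^sup>2 * C"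
  proof -
    show "0 < \<epsilon>" using C c R \<nu>(2) e by (simp add: \<epsilon>_def)
    have "\<epsilon> \<le> 1 / (2 * C\<^sup>2)" "\<epsilon> \<le> cmod \<nu> * c / (2 * R)" "\<epsilon> \<le> e * (cmod \<nu>)\<^sup>2 * C / (4 * pi * R)"
      by (simp_all add: \<epsilon>_def)
    then show "\<epsilon> * C\<^sup>2 \<le> 1 / 2" "\<epsilon> * R \<le> cmod \<nu> * c / 2" "4 * pi * \<epsilon> * R \<le> e * (cmod \<nu>)\<^sup>2 * C"
      using C R by (simp_all add: field_simps)
  qed
  obtain d1 where d1: "d1 > 0" "\<And>q. norm q < d1 \<Longrightarrow> norm (partial_y K q - \<nu> * fst q) \<le> \<epsilon> * norm q"
    using derivative_linear_bound[OF \<nu>(1) zero(3) \<epsilon>(1)] by blast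
  have K2: "cmod (partial_y K (x, y) - \<nu> * x) \<le> \<epsilon> * (cmod x + cmod y)" if "cmod x + cmod y < d1" for x y
  proof -
    have n: "norm (x, y) \<le> cmod x + cmod y" by (rule norm_Pair_le)
    then have "cmod (partial_y K (x, y) - \<nu> * x) \<le> \<epsilon> * norm (x, y)"
      using d1(2)[of "(x, y)"] that by simp
    also have "\<dots> \<le> \<epsilon> * (cmod x + cmod y)"
      using n \<epsilon>(1) by (intro mult_left_mono) auto
    finally show ?thesis .
  qed
  have main: "(\<forall>t\<in>{0..1}. partial_y K (\<Gamma> t, \<eta> t) \<noteq> 0) \<and> (\<exists>I. ((\<lambda>t. vector_derivative \<Gamma> (at t within {0..1}) / partial_y K (\<Gamma> t, \<eta> t)) has_integral I) {0..1} \<and>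
         cmod (I - 2 * of_real pi * \<i> / \<nu>) \<le> e)"
    if h: "h \<noteq> 0" "R * sqrt (cmod h) < min d0 d1"
      and \<Gamma>: "valid_path \<Gamma>" "pathfinish \<Gamma> = pathstart \<Gamma>" "winding_number \<Gamma> 0 = 1"
      and curve: "\<And>t. t \<in> {0..1} \<Longrightarrow> cmod (\<Gamma> t) \<le> C * sqrt (cmod h) \<and> cmod (\<eta> t) \<le> C * sqrt (cmod h) \<and> K (\<Gamma> t, \<eta> t) = h"
    for h \<Gamma> \<eta>
  proof -
    define \<rho> where "\<rho> = sqrt (cmod h)"
    have \<rho>: "0 < \<rho>" "\<rho>\<^sup>2 = cmod h" "R * \<rho> < d0" "R * \<rho> < d1" using h by (auto simp: \<rho>_def)
    have small: "cmod x + cmod y \<le> R * \<rho>" if "cmod x \<le> 2 * C * \<rho>" "cmod y \<le> B * \<rho>" for x y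
      using that by (simp add: R_def algebra_simps)
    have C\<rho>: "C * \<rho> \<le> B * \<rho>" "C * \<rho> \<le> 2 * C * \<rho>" "0 < C * \<rho>" using B(1) \<rho>(1) C by auto
    \<comment> \<open>On the scale \<open>\<rho>\<close> the curve stays away from \<open>\<zeta> = 0\<close>, because \<open>K (0, \<eta>)\<close> is \<open>o(\<eta>\<^sup>2)\<close>.\<close>
    have lower: "2 * c * \<rho> \<le> cmod \<zeta>" if "cmod \<zeta> \<le> C * \<rho>" "cmod y \<le> C * \<rho>" "K (\<zeta>, y) = h" for \<zeta> y
    proof -
      have "cmod (K (0, y) - K (0, 0)) \<le> (\<epsilon> * (C * \<rho>)) * cmod (y - 0)"
      proof (rule field_differentiable_bound[of "cball 0 (C * \<rho>)"])
        show "((\<lambda>y. K (0, y)) has_field_derivative partial_y K (0, z)) (at z within cball 0 (C * \<rho>))" for z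
          by (rule holomorphic2_partial_y_field[OF K(1)])
        fix z :: complex assume "z \<in> cball 0 (C * \<rho>)"
        then have z: "cmod z \<le> C * \<rho>" by simp
        have "cmod (partial_y K (0, z)) \<le> \<epsilon> * cmod z"
          using K2[of 0 z] small[of 0 z] z C\<rho> \<rho> by simp
        also have "\<dots> \<le> \<epsilon> * (C * \<rho>)" using z \<epsilon>(1) by simp
        finally show "cmod (partial_y K (0, z)) \<le> \<epsilon> * (C * \<rho>)" .
      qed (use that(2) C\<rho> in auto)
      also have "\<dots> \<le> (\<epsilon> * (C * \<rho>)) * (C * \<rho>)"
        using that(2) \<epsilon>(1) C\<rho> by (intro mult_left_mono) auto
      also have "\<dots> = (\<epsilon> * C\<^sup>2) * \<rho>\<^sup>2" by (simp add: power2_eq_square)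
      also have "\<dots> \<le> 1 / 2 * \<rho>\<^sup>2" using \<epsilon>(2) by (intro mult_right_mono) auto
      finally have 1: "cmod (K (0, y)) \<le> \<rho>\<^sup>2 / 2" using zero(1) by (simp add: zero_prod_def)
      have "cmod (K (\<zeta>, y) - K (0, y)) \<le> (M * (2 * C * \<rho>)) * cmod (\<zeta> - 0)"
      proof (rule field_differentiable_bound[of "cball 0 (C * \<rho>)" "\<lambda>x. K (x, y)"])
        show "((\<lambda>x. K (x, y)) has_field_derivative partial_x K (z, y)) (at z within cball 0 (C * \<rho>))" for z
          by (rule holomorphic2_partial_x_field[OF K(1)])
        fix z :: complex assume "z \<in> cball 0 (C * \<rho>)"
        then have z: "cmod z \<le> C * \<rho>" by simp
        have "cmod (partial_x K (z, y)) \<le> M * (cmod z + cmod y)"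
          using K1[of z y] small[of z y] z that(2) C\<rho> \<rho> by simp
        also have "\<dots> \<le> M * (2 * C * \<rho>)" using z that(2) M by (intro mult_left_mono) auto
        finally show "cmod (partial_x K (z, y)) \<le> M * (2 * C * \<rho>)" .
      qed (use that(1) C\<rho> in auto)
      then have "cmod h - cmod (K (0, y)) \<le> M * (2 * C * \<rho>) * cmod \<zeta>"
        using norm_triangle_ineq2[of h "K (0, y)"] that(3) by simp
      then have "\<rho>\<^sup>2 / 2 \<le> M * (2 * C * \<rho>) * cmod \<zeta>" using 1 \<rho>(2) by simp
      then have "\<rho> * \<rho> \<le> \<rho> * (4 * M * C * cmod \<zeta>)" by (simp add: power2_eq_square algebra_simps)
      then have "\<rho> \<le> 4 * M * C * cmod \<zeta>" using \<rho>(1) by simp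
      then show ?thesis using M C by (simp add: c_def field_simps)
    qed
    define A where "A = {z. c * \<rho> < cmod z \<and> cmod z < 2 * C * \<rho>}"
    have "open A"
      unfolding A_def by (intro open_Collect_conj open_Collect_less continuous_intros)
    have slope: "cmod (partial_y K (\<zeta>, y) - \<nu> * \<zeta>) \<le> \<epsilon> * R * \<rho>"
        "\<epsilon> * R * \<rho> \<le> cmod (\<nu> * \<zeta>) / 2"
      if "\<zeta> \<in> A" "cmod y \<le> B * \<rho>" for \<zeta> y
    proof -
      have "cmod (partial_y K (\<zeta>, y) - \<nu> * \<zeta>) \<le> \<epsilon> * (cmod \<zeta> + cmod y)"
        using K2[of \<zeta> y] small[of \<zeta> y] that \<rho> by (simp add: A_def)
      also have "\<dots> \<le> \<epsilon> * (R * \<rho>)"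
        using small[of \<zeta> y] that \<epsilon>(1) by (intro mult_left_mono) (auto simp: A_def)
      finally show "cmod (partial_y K (\<zeta>, y) - \<nu> * \<zeta>) \<le> \<epsilon> * R * \<rho>" by simp
      have "\<epsilon> * R * \<rho> \<le> cmod \<nu> * c / 2 * \<rho>" using \<epsilon>(3) \<rho>(1) by (intro mult_right_mono) auto
      also have "\<dots> \<le> cmod \<nu> * cmod \<zeta> / 2" using that \<nu>(2) by (simp add: A_def)
      finally show "\<epsilon> * R * \<rho> \<le> cmod (\<nu> * \<zeta>) / 2" by (simp add: norm_mult)
    qed
    have start: "cmod (K (\<zeta>, 0) - h) \<le> cmod (\<nu> * \<zeta>) * (B * \<rho>) / 2" if "\<zeta> \<in> A" for \<zeta>
    proof -
      have \<zeta>: "c * \<rho> < cmod \<zeta>" "cmod \<zeta> < 2 * C * \<rho>" using that by (auto simp: A_def)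
      have "cmod (K (\<zeta>, 0) - K (0, 0)) \<le> (M * (2 * C * \<rho>)) * cmod (\<zeta> - 0)"
      proof (rule field_differentiable_bound[of "cball 0 (2 * C * \<rho>)" "\<lambda>x. K (x, 0)"])
        show "((\<lambda>x. K (x, 0)) has_field_derivative partial_x K (z, 0)) (at z within cball 0 (2 * C * \<rho>))" for z
          by (rule holomorphic2_partial_x_field[OF K(1)])
        fix z :: complex assume "z \<in> cball 0 (2 * C * \<rho>)"
        then have z: "cmod z \<le> 2 * C * \<rho>" by simp
        have "cmod (partial_x K (z, 0)) \<le> M * (cmod z + cmod 0)"
          using K1[of z 0] small[of z 0] z C\<rho> \<rho> by simp
        also have "\<dots> \<le> M * (2 * C * \<rho>)" using z M by (intro mult_left_mono) auto
        finally show "cmod (partial_x K (z, 0)) \<le> M * (2 * C * \<rho>)" .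
      qed (use \<zeta> C\<rho> in auto)
      also have "\<dots> \<le> (M * (2 * C * \<rho>)) * (2 * C * \<rho>)"
        using \<zeta> M C\<rho> by (intro mult_left_mono) auto
      finally have "cmod (K (\<zeta>, 0)) \<le> 4 * M * C\<^sup>2 * \<rho>\<^sup>2"
        using zero(1) by (simp add: power2_eq_square zero_prod_def algebra_simps)
      then have "cmod (K (\<zeta>, 0) - h) \<le> 4 * M * C\<^sup>2 * \<rho>\<^sup>2 + \<rho>\<^sup>2"
        using norm_triangle_ineq4[of "K (\<zeta>, 0)" h] \<rho>(2) by simp
      also have "\<dots> = (2 * (1 + 4 * M * C\<^sup>2)) * \<rho>\<^sup>2 / 2" by (simp add: algebra_simps)
      also have "\<dots> \<le> (B * (cmod \<nu> * c)) * \<rho>\<^sup>2 / 2"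
        using B(2) by (intro divide_right_mono mult_right_mono) auto
      also have "\<dots> = (cmod \<nu> * (c * \<rho>)) * (B * \<rho>) / 2" by (simp add: power2_eq_square)
      also have "\<dots> \<le> (cmod \<nu> * cmod \<zeta>) * (B * \<rho>) / 2"
        using \<zeta> C\<rho> by (intro divide_right_mono mult_right_mono mult_left_mono) auto
      finally show ?thesis by (simp add: norm_mult)
    qed
    have nz: "\<nu> * \<zeta> \<noteq> 0" if "\<zeta> \<in> A" for \<zeta>
    proof -
      have "0 < c * \<rho>" using c(1) \<rho>(1) by simp
      then show ?thesis using that \<nu>(2) by (auto simp: A_def)
    qed
    obtain \<phi> where \<phi>: "\<phi> holomorphic_on A" "\<And>x. x \<in> A \<Longrightarrow> \<phi> x \<in> cball 0 (B * \<rho>)"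
      "\<And>x. x \<in> A \<Longrightarrow> K (x, \<phi> x) = h"
      "\<And>x y. x \<in> A \<Longrightarrow> y \<in> cball 0 (B * \<rho>) \<Longrightarrow> K (x, y) = h \<Longrightarrow> y = \<phi> x"
    proof (rule implicit_function[of K A "B * \<rho>" "\<lambda>\<zeta>. \<nu> * \<zeta>" 0 h])
      show "cmod (partial_y K (\<zeta>, y) - \<nu> * \<zeta>) \<le> cmod (\<nu> * \<zeta>) / 2" if "\<zeta> \<in> A" "y \<in> cball 0 (B * \<rho>)" for \<zeta> y
        using slope[of \<zeta> y] that by simp
      show "continuous_on A ((*) \<nu>)" by (intro continuous_intros)
    qed (use K \<open>open A\<close> C\<rho> start nz in auto)
    have large: "cmod (\<nu> * \<zeta>) / 2 \<le> cmod (partial_y K (\<zeta>, \<phi> \<zeta>))" if "\<zeta> \<in> A" for \<zeta>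
    proof -
      have "cmod (partial_y K (\<zeta>, \<phi> \<zeta>) - \<nu> * \<zeta>) \<le> cmod (\<nu> * \<zeta>) / 2"
        using slope[of \<zeta> "\<phi> \<zeta>"] \<phi>(2)[OF that] that by simp
      moreover have "cmod (\<nu> * \<zeta>) \<le> cmod (partial_y K (\<zeta>, \<phi> \<zeta>)) + cmod (partial_y K (\<zeta>, \<phi> \<zeta>) - \<nu> * \<zeta>)"
        by (metis norm_minus_commute norm_triangle_sub)
      ultimately show ?thesis by linarith
    qed
    have K2_nz: "partial_y K (\<zeta>, \<phi> \<zeta>) \<noteq> 0" if "\<zeta> \<in> A" for \<zeta>
    proof -
      have "0 < cmod (\<nu> * \<zeta>) / 2" using nz[OF that] by simp
      then show ?thesis using large[OF that] by auto
    qed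
    define f where "f \<zeta> = 1 / partial_y K (\<zeta>, \<phi> \<zeta>)" for \<zeta>
    have "f holomorphic_on A"
      unfolding f_def
    proof (intro holomorphic_on_divide holomorphic_on_const)
      have "((\<lambda>x. partial_y K (x, \<phi> x)) has_field_derivative
          partial_x (partial_y K) (x, \<phi> x) * 1 + partial_y (partial_y K) (x, \<phi> x) * deriv \<phi> x) (at x)" if "x \<in> A" for x
        using \<phi>(1) that \<open>open A\<close> by (intro holomorphic2_compose K) (auto intro: holomorphic_derivI)
      then show "(\<lambda>x. partial_y K (x, \<phi> x)) holomorphic_on A"
        unfolding holomorphic_on_open[OF \<open>open A\<close>] by blast
    qed (use K2_nz in blast)
    have range: "cmod (\<Gamma> t) \<in> {2 * c * \<rho>..C * \<rho>}" if "t \<in> {0..1}" for t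
      using curve[OF that] lower[of "\<Gamma> t" "\<eta> t"] by (simp add: \<rho>_def)
    have sub: "{z. cmod z \<in> {2 * c * \<rho>..C * \<rho>}} \<subseteq> A"
    proof
      fix z :: complex assume z: "z \<in> {z. cmod z \<in> {2 * c * \<rho>..C * \<rho>}}"
      have "c * \<rho> < 2 * c * \<rho>" "C * \<rho> < 2 * C * \<rho>" using c(1) \<rho>(1) C by auto
      moreover have "2 * c * \<rho> \<le> cmod z" "cmod z \<le> C * \<rho>" using z by auto
      ultimately have "c * \<rho> < cmod z" "cmod z < 2 * C * \<rho>" by linarith+
      then show "z \<in> A" by (simp add: A_def)
    qed
    have "homotopic_loops {z. cmod z \<in> {2 * c * \<rho>..C * \<rho>}} \<Gamma> (circlepath 0 (C * \<rho>))"
      using \<Gamma> range c \<rho>(1) by (intro homotopic_to_circle_in_annulus) (auto simp: valid_path_imp_path)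
    then have "homotopic_loops A \<Gamma> (circlepath 0 (C * \<rho>))"
      using sub by (rule homotopic_loops_subset)
    then have eq: "contour_integral \<Gamma> f = contour_integral (circlepath 0 (C * \<rho>)) f"
      using \<open>open A\<close> \<open>f holomorphic_on A\<close> \<Gamma>(1) by (intro Cauchy_theorem_homotopic_loops) auto
    have circle: "path_image (circlepath 0 (C * \<rho>)) \<subseteq> A"
      using sub c C\<rho> \<rho>(1) by (auto simp: path_image_circlepath subset_iff sphere_def mult_right_mono)
    have "f contour_integrable_on circlepath 0 (C * \<rho>)"
      using \<open>f holomorphic_on A\<close> \<open>open A\<close> circle by (intro contour_integrable_holomorphic_simple) auto
    then have 1: "(f has_contour_integral contour_integral \<Gamma> f) (circlepath 0 (C * \<rho>))"
      unfolding eq by (rule has_contour_integral_integral)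
    have 2: "((\<lambda>\<zeta>. (1 / \<nu>) * (1 / (\<zeta> - 0))) has_contour_integral (1 / \<nu>) * (2 * of_real pi * \<i>)) (circlepath 0 (C * \<rho>))"
    proof (rule has_contour_integral_lmul)
      show "((\<lambda>\<zeta>. 1 / (\<zeta> - 0)) has_contour_integral 2 * of_real pi * \<i>) (circlepath 0 (C * \<rho>))"
        using Cauchy_integral_circlepath_simple[of "\<lambda>_. 1" 0 "C * \<rho>" 0] C\<rho>(3) by simp
    qed
    have "cmod (contour_integral \<Gamma> f - (1 / \<nu>) * (2 * of_real pi * \<i>)) \<le>
        (2 * \<epsilon> * R / ((cmod \<nu>)\<^sup>2 * C\<^sup>2 * \<rho>)) * (2 * pi * (C * \<rho>))"
    proof (rule has_contour_integral_bound_circlepath[OF has_contour_integral_diff[OF 1 2]])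
      show "0 \<le> 2 * \<epsilon> * R / ((cmod \<nu>)\<^sup>2 * C\<^sup>2 * \<rho>)" using \<epsilon>(1) R \<rho>(1) by simp
      fix z assume "cmod (z - 0) = C * \<rho>"
      then have z: "cmod z = C * \<rho>" by simp
      then have zA: "z \<in> A" using circle C\<rho>(3) by (auto simp: path_image_circlepath)
      define k where "k = partial_y K (z, \<phi> z)"
      have k: "cmod (\<nu> * z) / 2 \<le> cmod k" "cmod (k - \<nu> * z) \<le> \<epsilon> * R * \<rho>"
        using large[OF zA] slope(1)[OF zA, of "\<phi> z"] \<phi>(2)[OF zA] by (auto simp: k_def)
      have pos: "0 < cmod (\<nu> * z)" using nz[OF zA] by simp
      then have "k \<noteq> 0" using k(1) by auto
      then have "f z - (1 / \<nu>) * (1 / (z - 0)) = - ((k - \<nu> * z) / (k * (\<nu> * z)))"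
        using pos by (simp add: f_def k_def[symmetric] field_simps)
      then have "cmod (f z - (1 / \<nu>) * (1 / (z - 0))) = cmod (k - \<nu> * z) / (cmod k * cmod (\<nu> * z))"
        by (simp only: norm_minus_cancel norm_divide norm_mult)
      also have "\<dots> \<le> (\<epsilon> * R * \<rho>) / (cmod (\<nu> * z) / 2 * cmod (\<nu> * z))"
        using k pos \<epsilon>(1) R \<rho>(1) by (intro frac_le mult_mono) auto
      also have "\<dots> = 2 * \<epsilon> * R / ((cmod \<nu>)\<^sup>2 * C\<^sup>2 * \<rho>)"
        using C \<rho>(1) \<nu>(2) by (simp add: norm_mult z power2_eq_square field_simps)
      finally show "cmod (f z - (1 / \<nu>) * (1 / (z - 0))) \<le> 2 * \<epsilon> * R / ((cmod \<nu>)\<^sup>2 * C\<^sup>2 * \<rho>)" .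
    qed (use C\<rho> in auto)
    also have "\<dots> = 4 * pi * \<epsilon> * R / ((cmod \<nu>)\<^sup>2 * C)"
      using C \<rho>(1) \<nu>(2) by (simp add: power2_eq_square field_simps)
    also have "\<dots> \<le> e"
      using \<epsilon>(4) C \<nu>(2) by (simp add: pos_divide_le_eq mult.assoc)
    finally have bound: "cmod (contour_integral \<Gamma> f - 2 * of_real pi * \<i> / \<nu>) \<le> e" by simp
    have img: "path_image \<Gamma> \<subseteq> A" using range sub by (auto simp: path_image_def)
    then have "f contour_integrable_on \<Gamma>"
      using \<open>f holomorphic_on A\<close> \<open>open A\<close> \<Gamma>(1) by (intro contour_integrable_holomorphic_simple)
    then have "((\<lambda>t. f (\<Gamma> t) * vector_derivative \<Gamma> (at t within {0..1})) has_integral contour_integral \<Gamma> f) {0..1}"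
      using has_contour_integral_integral unfolding has_contour_integral_def by blast
    moreover have graph: "\<Gamma> t \<in> A \<and> \<eta> t = \<phi> (\<Gamma> t)" if "t \<in> {0..1}" for t
    proof -
      have "\<Gamma> t \<in> A" using that img by (auto simp: path_image_def)
      moreover have "\<eta> t \<in> cball 0 (B * \<rho>)" using curve[OF that] C\<rho>(1) by (simp add: \<rho>_def)
      ultimately show ?thesis using \<phi>(4) curve[OF that] by blast
    qed
    then have "f (\<Gamma> t) * vector_derivative \<Gamma> (at t within {0..1}) =
        vector_derivative \<Gamma> (at t within {0..1}) / partial_y K (\<Gamma> t, \<eta> t)" if "t \<in> {0..1}" for t
      using that by (simp add: f_def)
    ultimately have "((\<lambda>t. vector_derivative \<Gamma> (at t within {0..1}) / partial_y K (\<Gamma> t, \<eta> t)) has_integral contour_integral \<Gamma> f) {0..1}"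
      by (rule has_integral_eq[rotated])
    moreover have "\<forall>t\<in>{0..1}. partial_y K (\<Gamma> t, \<eta> t) \<noteq> 0"
      using graph K2_nz by fastforce
    ultimately show ?thesis using bound by blast
  qed
  have "((\<lambda>h. R * sqrt (cmod h)) \<longlongrightarrow> R * sqrt (cmod 0)) (at 0)"
    by (intro tendsto_intros)
  then have "\<forall>\<^sub>F h in at 0. R * sqrt (cmod h) < min d0 d1"
    by (rule order_tendstoD) (use d0 d1 in simp)
  moreover have "\<forall>\<^sub>F h in at 0. h \<noteq> (0::complex)"
    by (simp add: eventually_at_filter)
  ultimately show ?thesis
    by eventually_elim (use main in blast)
qed

section \<open>The period of a vanishing cycle\<close>

lemma holomorphic2_lincomb:
  assumes "holomorphic2 F" "holomorphic2 G"
  shows "holomorphic2 (\<lambda>q. a * F q + b * G q)"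
proof -
  have "((\<lambda>q. a * F q + b * G q) has_derivative
      (\<lambda>v. (a * partial_x F q + b * partial_x G q) * fst v + (a * partial_y F q + b * partial_y G q) * snd v)) (at q)" for q
    by (rule has_derivative_eq_rhs[OF has_derivative_add[OF has_derivative_mult_right has_derivative_mult_right,
          OF holomorphic2_has_derivative[OF assms(1)] holomorphic2_has_derivative[OF assms(2)]]])
      (simp add: fun_eq_iff algebra_simps)
  then show ?thesis unfolding holomorphic2_def by blast
qed

lemma has_derivative_affine:
  fixes p :: "complex \<times> complex" and a b c d :: complex
  shows "((\<lambda>q. p + (a * fst q + b * snd q, c * fst q + d * snd q)) has_derivative
    (\<lambda>v. (a * fst v + b * snd v, c * fst v + d * snd v))) (at q)"
  by (auto intro!: derivative_eq_intros)

lemma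
  fixes F :: "complex \<times> complex \<Rightarrow> complex" and p :: "complex \<times> complex" and a b c d :: complex
  assumes F: "holomorphic2 F"
  defines "L \<equiv> \<lambda>q. p + (a * fst q + b * snd q, c * fst q + d * snd q)"
  shows holomorphic2_affine: "holomorphic2 (F \<circ> L)"
    and partial_x_affine: "partial_x (F \<circ> L) = (\<lambda>q. a * (partial_x F \<circ> L) q + c * (partial_y F \<circ> L) q)"
    and partial_y_affine: "partial_y (F \<circ> L) = (\<lambda>q. b * (partial_x F \<circ> L) q + d * (partial_y F \<circ> L) q)"
proof -
  have deriv: "((F \<circ> L) has_derivative (\<lambda>v. (a * (partial_x F \<circ> L) q + c * (partial_y F \<circ> L) q) * fst v +
      (b * (partial_x F \<circ> L) q + d * (partial_y F \<circ> L) q) * snd v)) (at q)" for q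
  proof -
    have "(L has_derivative (\<lambda>v. (a * fst v + b * snd v, c * fst v + d * snd v))) (at q)"
      unfolding L_def by (rule has_derivative_affine)
    from diff_chain_at[OF this holomorphic2_has_derivative[OF F]] show ?thesis
      by (rule has_derivative_eq_rhs) (simp add: fun_eq_iff algebra_simps)
  qed
  then show "holomorphic2 (F \<circ> L)" unfolding holomorphic2_def by blast
  show "partial_x (F \<circ> L) = (\<lambda>q. a * (partial_x F \<circ> L) q + c * (partial_y F \<circ> L) q)"
    "partial_y (F \<circ> L) = (\<lambda>q. b * (partial_x F \<circ> L) q + d * (partial_y F \<circ> L) q)"
    using has_derivative_pair_partials[OF deriv] by (simp_all add: fun_eq_iff)
qed

text \<open>
  Tangent vectors are multiples of the Hamiltonian field, and \<open>omega\<close> is the factor, that is, the time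
  differential of the flow.
\<close>

lemma tangent_vector_eq_omega:
  assumes "partial_x H q \<noteq> 0 \<or> partial_y H q \<noteq> 0" "tangent_vector H q v"
  shows "fst v = omega H q v * partial_y H q" "snd v = - omega H q v * partial_x H q"
proof -
  have "partial_x H q * fst v = - partial_y H q * snd v"
    using assms(2) by (simp add: tangent_vector_def eq_neg_iff_add_eq_0)
  then have "fst v = omega H q v * partial_y H q \<and> snd v = - omega H q v * partial_x H q"
    using assms(1) by (auto simp: omega_def field_simps)
  then show "fst v = omega H q v * partial_y H q" "snd v = - omega H q v * partial_x H q" by auto
qed

lemma valid_path_linear_image:
  assumes g: "valid_path g" and f: "bounded_linear f"
  shows "valid_path (\<lambda>t. f (g t - p))"
proof -
  obtain E D where E: "finite E" "continuous_on {0..1} g" "continuous_on ({0..1} - E) D"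
    "\<And>t. t \<in> {0..1} - E \<Longrightarrow> (g has_vector_derivative D t) (at t)"
    using g unfolding valid_path_def piecewise_C1_differentiable_on_def C1_differentiable_on_def by blast
  have "continuous_on {0..1} (\<lambda>t. f (g t - p))"
    by (intro bounded_linear.continuous_on[OF f] continuous_intros E)
  moreover have "((\<lambda>t. f (g t - p)) has_vector_derivative f (D t)) (at t)" if "t \<in> {0..1} - E" for t
    using E(4)[OF that] by (intro bounded_linear.has_vector_derivative[OF f]) (auto intro!: derivative_eq_intros)
  moreover have "continuous_on ({0..1} - E) (\<lambda>t. f (D t))"
    by (intro bounded_linear.continuous_on[OF f] E)
  ultimately show ?thesis
    unfolding valid_path_def piecewise_C1_differentiable_on_def C1_differentiable_on_def
    using E(1) by (intro conjI exI[of _ E] exI[of _ "\<lambda>t. f (D t)"] ballI) auto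
qed

text \<open>
  If \<open>l\<close> is an eigen-coordinate for \<open>\<mu>\<close>, then \<open>dl = l(X) dt\<close> on the curve, where \<open>X\<close> is the
  Hamiltonian field, \<open>dt = omega\<close>, and \<open>l(X)\<close> is \<open>\<mu> l\<close> to first order. In linear coordinates
  \<open>(\<zeta>, \<eta>)\<close> with \<open>\<zeta> = l\<close>, the derivative of \<open>H\<close> in a suitably normalised \<open>\<eta>\<close>-direction is \<open>l(X)\<close>, so
  the integrand is the one of \<open>annulus_integral\<close> with \<open>\<nu> = \<mu>\<close>.
\<close>

theorem vanishing_cycle_period:
  fixes H :: "complex \<times> complex \<Rightarrow> complex" and \<mu> :: complex
  assumes H: "holomorphic2 H" "holomorphic2 (partial_x H)" "holomorphic2 (partial_y H)"
    and p: "H p = 0" "partial_x H p = 0" "partial_y H p = 0"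
    and smooth: "\<forall>\<^sub>F h in at 0. \<forall>q\<in>level_curve H h. partial_x H q \<noteq> 0 \<or> partial_y H q \<noteq> 0"
    and \<gamma>: "\<forall>\<^sub>F h in at 0. C1_loop_in (level_curve H h) (\<gamma> h)" "represents H \<gamma> c"
    and size: "\<forall>\<^sub>F h in at 0. path_image (\<gamma> h) \<subseteq> cball p (C * sqrt (cmod h))"
    and l: "eigen_coordinate H p \<mu> l" and \<mu>: "\<mu> \<noteq> 0"
    and wind: "\<forall>\<^sub>F h in at 0. winding_number (\<lambda>t. l (\<gamma> h t - p)) 0 = 1"
  shows "((\<lambda>h. period H h (c h)) \<longlongrightarrow> 2 * of_real pi * \<i> / \<mu>) (at 0)"
proof -
  obtain a b where ab: "(a, b) \<noteq> (0, 0)" and l_def: "l = (\<lambda>w. a * fst w + b * snd w)"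
    and eigen: "\<And>w. l (linearization H p w) = \<mu> * l w"
    using l unfolding eigen_coordinate_def by blast
  define D where "D = a * cnj a + b * cnj b"
  have D: "D \<noteq> 0"
  proof -
    have "D = of_real ((cmod a)\<^sup>2 + (cmod b)\<^sup>2)" 
      by (simp only: D_def of_real_add complex_norm_square)
    moreover have "(cmod a)\<^sup>2 + (cmod b)\<^sup>2 \<noteq> 0"
      using ab by (simp add: sum_power2_eq_zero_iff)
    ultimately show ?thesis by (simp only: of_real_eq_0_iff not_False_eq_True)
  qed
  \<comment> \<open>A second linear coordinate \<open>k\<close>, normalised so that the direction of \<open>k\<close> at constant \<open>l\<close> is \<open>(-b, a)\<close>;
    the derivative of \<open>H\<close> in that direction is \<open>l\<close> of the Hamiltonian field.\<close>
  define k where "k w = (- cnj b * fst w + cnj a * snd w) / D" for w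
  define L where "L q = p + ((cnj a / D) * fst q + (- b) * snd q, (cnj b / D) * fst q + a * snd q)" for q
  have L: "L (l w, k w) = p + w" for w
  proof -
    have "cnj a / D * (a * fst w + b * snd w) + (- b) * ((- cnj b * fst w + cnj a * snd w) / D) = ((a * cnj a + b * cnj b) / D) * fst w"
      by (simp add: add_divide_distrib diff_divide_distrib algebra_simps)
    moreover have "cnj b / D * (a * fst w + b * snd w) + a * ((- cnj b * fst w + cnj a * snd w) / D) = ((a * cnj a + b * cnj b) / D) * snd w"
      by (simp add: add_divide_distrib diff_divide_distrib algebra_simps)
    ultimately show ?thesis using D by (simp only: D_def[symmetric]) (simp add: L_def l_def k_def prod_eq_iff)
  qed
  have l_L: "l (L q - p) = fst q" for q
  proof -
    have "a * (cnj a / D * fst q + - b * snd q) + b * (cnj b / D * fst q + a * snd q) = ((a * cnj a + b * cnj b) / D) * fst q"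
      by (simp add: add_divide_distrib diff_divide_distrib algebra_simps)
    then show ?thesis using D by (simp only: D_def[symmetric]) (simp add: l_def L_def)
  qed
  define K where "K = H \<circ> L"
  have L_eq: "L = (\<lambda>q. p + ((cnj a / D) * fst q + (- b) * snd q, (cnj b / D) * fst q + a * snd q))"
    by (simp add: L_def fun_eq_iff)
  have K: "holomorphic2 K"
    unfolding K_def L_eq by (rule holomorphic2_affine[OF H(1)])
  have K_x: "partial_x K = (\<lambda>q. (cnj a / D) * (partial_x H \<circ> L) q + (cnj b / D) * (partial_y H \<circ> L) q)"
    unfolding K_def L_eq by (rule partial_x_affine[OF H(1)])
  have K_y: "partial_y K = (\<lambda>q. (- b) * (partial_x H \<circ> L) q + a * (partial_y H \<circ> L) q)"
    unfolding K_def L_eq by (rule partial_y_affine[OF H(1)])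
  have HL: "holomorphic2 (partial_x H \<circ> L)" "holomorphic2 (partial_y H \<circ> L)"
    unfolding L_eq by (intro holomorphic2_affine H)+
  have L0: "L 0 = p" by (simp add: L_def zero_prod_def)
  have "((\<lambda>q. (- b) * partial_x H q + a * partial_y H q) has_derivative (\<lambda>w. l (linearization H p w))) (at (L 0))"
    unfolding L0
    by (rule has_derivative_eq_rhs[OF has_derivative_add[OF has_derivative_mult_right has_derivative_mult_right,
          OF holomorphic2_has_derivative[OF H(2)] holomorphic2_has_derivative[OF H(3)]]])
      (simp add: fun_eq_iff l_def linearization_def algebra_simps)
  moreover have "(L has_derivative (\<lambda>v. L v - p)) (at 0)"
    unfolding L_eq by (rule has_derivative_eq_rhs[OF has_derivative_affine]) simp
  ultimately have "((\<lambda>q. (- b) * partial_x H (L q) + a * partial_y H (L q)) has_derivative (\<lambda>v. l (linearization H p (L v - p)))) (at 0)"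
    by (rule has_derivative_compose[rotated])
  then have K_y_deriv: "(partial_y K has_derivative (\<lambda>v. \<mu> * fst v)) (at 0)"
    unfolding K_y eigen l_L by simp
  define C' where "C' = max 1 (\<bar>C\<bar> * (cmod a + cmod b) * (1 + 1 / cmod D))"
  have bound: "cmod (l w) \<le> C' * s" "cmod (k w) \<le> C' * s" if "norm w \<le> C * s" "0 \<le> s" for w s
  proof -
    have w: "cmod (fst w) \<le> \<bar>C\<bar> * s" "cmod (snd w) \<le> \<bar>C\<bar> * s"
      using that norm_fst_le[of "fst w" "snd w"] norm_snd_le[of "snd w" "fst w"]
        mult_right_mono[OF abs_ge_self[of C] that(2)] by (auto intro: order_trans)
    have *: "cmod (\<alpha> * fst w + \<beta> * snd w) \<le> (cmod \<alpha> + cmod \<beta>) * (\<bar>C\<bar> * s)" for \<alpha> \<beta>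
    proof -
      have "cmod (\<alpha> * fst w + \<beta> * snd w) \<le> cmod \<alpha> * cmod (fst w) + cmod \<beta> * cmod (snd w)"
        by (metis norm_mult norm_triangle_ineq)
      also have "\<dots> \<le> cmod \<alpha> * (\<bar>C\<bar> * s) + cmod \<beta> * (\<bar>C\<bar> * s)"
        using w by (intro add_mono mult_left_mono) auto
      finally show ?thesis by (simp add: distrib_right)
    qed
    define m where "m = (cmod a + cmod b) * (\<bar>C\<bar> * s)"
    have m: "0 \<le> m" using that by (simp add: m_def)
    have big: "m * (1 + 1 / cmod D) \<le> C' * s"
    proof -
      have "m * (1 + 1 / cmod D) = (\<bar>C\<bar> * (cmod a + cmod b) * (1 + 1 / cmod D)) * s"
        by (simp add: m_def)
      also have "\<dots> \<le> C' * s" using that(2) by (intro mult_right_mono) (auto simp: C'_def)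
      finally show ?thesis .
    qed
    have "cmod (l w) \<le> m" using *[of a b] by (simp add: l_def m_def)
    also have "m \<le> m * (1 + 1 / cmod D)" using m by (simp add: distrib_left)
    finally show "cmod (l w) \<le> C' * s" using big by linarith
    have "cmod (k w) = cmod (- cnj b * fst w + cnj a * snd w) / cmod D" by (simp add: k_def norm_divide)
    also have "\<dots> \<le> m / cmod D"
      using *[of "- cnj b" "cnj a"] by (intro divide_right_mono) (auto simp: m_def add.commute)
    also have "\<dots> \<le> m * (1 + 1 / cmod D)" using m by (simp add: distrib_left)
    finally show "cmod (k w) \<le> C' * s" using big by linarith
  qed
  show ?thesis
  proof (rule tendstoI)
    fix e :: real assume e: "0 < e"
    have "\<forall>\<^sub>F h in at 0. \<forall>\<Gamma> \<eta>. valid_path \<Gamma> \<longrightarrow> pathfinish \<Gamma> = pathstart \<Gamma> \<longrightarrow> winding_number \<Gamma> 0 = 1 \<longrightarrow>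
      (\<forall>t\<in>{0..1}. cmod (\<Gamma> t) \<le> C' * sqrt (cmod h) \<and> cmod (\<eta> t) \<le> C' * sqrt (cmod h) \<and> K (\<Gamma> t, \<eta> t) = h) \<longrightarrow>
      (\<forall>t\<in>{0..1}. partial_y K (\<Gamma> t, \<eta> t) \<noteq> 0) \<and>
      (\<exists>I. ((\<lambda>t. vector_derivative \<Gamma> (at t within {0..1}) / partial_y K (\<Gamma> t, \<eta> t)) has_integral I) {0..1} \<and>
         cmod (I - 2 * of_real pi * \<i> / \<mu>) \<le> e / 2)"
    proof (rule annulus_integral[OF K _ _ _ _ _ K_y_deriv \<mu>])
      show "holomorphic2 (partial_x K)" "holomorphic2 (partial_y K)"
        unfolding K_x K_y by (intro holomorphic2_lincomb HL)+
      show "K 0 = 0" "partial_x K 0 = 0" "partial_y K 0 = 0"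
        by (simp_all add: K_x K_y L0 p) (simp add: K_def L0 p)
      show "1 \<le> C'" by (simp add: C'_def)
    qed (use e in simp)
    moreover have "\<forall>\<^sub>F h in at 0. loop_class (level_curve H h) (\<gamma> h) = c h"
      using \<gamma>(2) by (simp add: represents_def)
    ultimately show "\<forall>\<^sub>F h in at 0. dist (period H h (c h)) (2 * of_real pi * \<i> / \<mu>) < e"
      using smooth \<gamma>(1) size wind
    proof eventually_elim
      case (elim h)
      interpret smooth_level H h
        using H elim(3) by unfold_locales auto
      define g where "g = \<gamma> h"
      define \<Gamma> \<eta> where "\<Gamma> = (\<lambda>t. l (g t - p))" and "\<eta> = (\<lambda>t. k (g t - p))"
      have bl: "bounded_linear l" "bounded_linear k"
      proof -
        have lin: "bounded_linear (\<lambda>w. \<alpha> * fst w + \<beta> * snd w)" for \<alpha> \<beta> :: complex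
          by (intro bounded_linear_add bounded_linear_const_mult bounded_linear_fst bounded_linear_snd)
        show "bounded_linear l" unfolding l_def by (rule lin)
        show "bounded_linear k" unfolding k_def
          by (rule bounded_linear_compose[OF bounded_linear_divide lin])
      qed
      have g: "C1_loop_in S g" using elim(4) by (simp add: g_def)
      have vp: "valid_path \<Gamma>"
        unfolding \<Gamma>_def using g bl by (intro valid_path_linear_image) (auto simp: C1_loop_in_def)
      have closed: "pathfinish \<Gamma> = pathstart \<Gamma>"
        using g by (simp add: C1_loop_in_def pathfinish_def pathstart_def \<Gamma>_def)
      have coords: "L (\<Gamma> t, \<eta> t) = g t" for t
        by (simp add: \<Gamma>_def \<eta>_def L)
      have curve: "cmod (\<Gamma> t) \<le> C' * sqrt (cmod h) \<and> cmod (\<eta> t) \<le> C' * sqrt (cmod h) \<and> K (\<Gamma> t, \<eta> t) = h"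
        if "t \<in> {0..1}" for t
      proof -
        have "g t \<in> path_image g" using that by (simp add: path_image_def)
        moreover have "path_image g \<subseteq> cball p (C * sqrt (cmod h))" "path_image g \<subseteq> S"
          using elim(5) g by (simp_all add: g_def C1_loop_in_def)
        ultimately have "g t \<in> cball p (C * sqrt (cmod h))" "g t \<in> S" by blast+
        then have "norm (g t - p) \<le> C * sqrt (cmod h)" "g t \<in> S"
          by (simp_all add: dist_norm norm_minus_commute)
        then show ?thesis
          using bound[of "g t - p" "sqrt (cmod h)"] by (auto simp: \<Gamma>_def \<eta>_def K_def L level_curve_def)
      qed
      have "winding_number \<Gamma> 0 = 1" using elim(6) by (simp add: \<Gamma>_def g_def)
      then obtain I where nz: "\<And>t. t \<in> {0..1} \<Longrightarrow> partial_y K (\<Gamma> t, \<eta> t) \<noteq> 0"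
        and I: "((\<lambda>t. vector_derivative \<Gamma> (at t within {0..1}) / partial_y K (\<Gamma> t, \<eta> t)) has_integral I) {0..1}"
           "cmod (I - 2 * of_real pi * \<i> / \<mu>) \<le> e / 2"
        using elim(1) vp closed curve by blast
      obtain E where E: "finite E" "\<And>t. t \<in> {0..1} - E \<Longrightarrow> t \<in> {0<..<1} \<and>
           tangent_vector H (g t) (vector_derivative g (at t within {0..1})) \<and>
           (g has_vector_derivative vector_derivative g (at t within {0..1})) (at t)"
        using path_tangent[OF g] by metis
      have "omega H (g t) (vector_derivative g (at t within {0..1})) =
          vector_derivative \<Gamma> (at t within {0..1}) / partial_y K (\<Gamma> t, \<eta> t)" if t: "t \<in> {0..1} - E" for t
      proof -
        let ?v = "vector_derivative g (at t within {0..1})"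
        have "g t \<in> S" using t g by (auto simp: C1_loop_in_def path_image_def)
        then have ns: "partial_x H (g t) \<noteq> 0 \<or> partial_y H (g t) \<noteq> 0" by (rule smooth)
        have "((\<lambda>t. l (g t - p)) has_vector_derivative l ?v) (at t)"
          using E(2)[OF t] by (intro bounded_linear.has_vector_derivative[OF bl(1)]) (auto intro!: derivative_eq_intros)
        then have "vector_derivative \<Gamma> (at t within {0..1}) = l ?v"
          unfolding \<Gamma>_def using t by (intro vector_derivative_at_within_ivl) auto
        also have "\<dots> = omega H (g t) ?v * partial_y K (\<Gamma> t, \<eta> t)"
        proof -
          have "tangent_vector H (g t) ?v" using E(2)[OF t] by blast
          note tv = tangent_vector_eq_omega[OF ns this]
          have "l ?v = a * (omega H (g t) ?v * partial_y H (g t)) + b * (- omega H (g t) ?v * partial_x H (g t))"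
            unfolding l_def by (subst tv(1), subst tv(2)) (rule refl)
          then show ?thesis by (simp add: K_y coords algebra_simps)
        qed
        finally show ?thesis using nz[of t] t by simp
      qed
      then have "has_omega_integral H g I"
        unfolding has_omega_integral_def by (rule has_integral_spike_finite[OF E(1) _ I(1)])
      then have "period H h (c h) = I"
        using period_eq[OF g] elim(2) by (simp add: g_def)
      then show ?case using I(2) e by (simp add: dist_norm)
    qed
  qed
qed

section \<open>A saddle plus a homogeneous form\<close>

text \<open>
  Polynomials are kept as sums over an arbitrary index set, because this shape is preserved by
  partial derivatives.
\<close>

lemma
  fixes c :: "'i \<Rightarrow> complex" and i j :: "'i \<Rightarrow> nat"
  assumes F: "\<And>q. F q = (\<Sum>k\<in>I. c k * fst q ^ i k * snd q ^ j k)"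
  shows holomorphic2_polynomial: "holomorphic2 F"
    and partial_x_polynomial: "partial_x F q = (\<Sum>k\<in>I. (c k * of_nat (i k)) * fst q ^ (i k - 1) * snd q ^ j k)"
    and partial_y_polynomial: "partial_y F q = (\<Sum>k\<in>I. (c k * of_nat (j k)) * fst q ^ i k * snd q ^ (j k - 1))"
proof -
  have F_eq: "F = (\<lambda>q. \<Sum>k\<in>I. c k * fst q ^ i k * snd q ^ j k)"
    using F by (simp add: fun_eq_iff)
  have deriv: "(F has_derivative (\<lambda>v. (\<Sum>k\<in>I. (c k * of_nat (i k)) * fst q ^ (i k - 1) * snd q ^ j k) * fst v +
      (\<Sum>k\<in>I. (c k * of_nat (j k)) * fst q ^ i k * snd q ^ (j k - 1)) * snd v)) (at q)" for q
  proof -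
    have "(F has_derivative (\<lambda>v. \<Sum>k\<in>I. (c k * of_nat (i k)) * fst q ^ (i k - 1) * snd q ^ j k * fst v +
        (c k * of_nat (j k)) * fst q ^ i k * snd q ^ (j k - 1) * snd v)) (at q)"
      unfolding F_eq
    proof (rule has_derivative_sum)
      fix k
      have x: "((\<lambda>q. fst q ^ i k) has_derivative (\<lambda>v. of_nat (i k) * fst v * fst q ^ (i k - 1))) (at q)"
        by (rule has_derivative_power[OF has_derivative_fst[OF has_derivative_ident]])
      have y: "((\<lambda>q. snd q ^ j k) has_derivative (\<lambda>v. of_nat (j k) * snd v * snd q ^ (j k - 1))) (at q)"
        by (rule has_derivative_power[OF has_derivative_snd[OF has_derivative_ident]])
      show "((\<lambda>q. c k * fst q ^ i k * snd q ^ j k) has_derivative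
          (\<lambda>v. (c k * of_nat (i k)) * fst q ^ (i k - 1) * snd q ^ j k * fst v +
            (c k * of_nat (j k)) * fst q ^ i k * snd q ^ (j k - 1) * snd v)) (at q)"
        by (rule has_derivative_eq_rhs[OF has_derivative_mult[OF has_derivative_mult_right[OF x] y]])
          (simp add: fun_eq_iff algebra_simps)
    qed
    then show ?thesis by (simp add: sum.distrib sum_distrib_right)
  qed
  then show "holomorphic2 F" unfolding holomorphic2_def by blast
  show "partial_x F q = (\<Sum>k\<in>I. (c k * of_nat (i k)) * fst q ^ (i k - 1) * snd q ^ j k)"
    and "partial_y F q = (\<Sum>k\<in>I. (c k * of_nat (j k)) * fst q ^ i k * snd q ^ (j k - 1))"
    using has_derivative_pair_partials[OF deriv] by blast+
qed

locale saddle_plus_form =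
  fixes a :: "nat \<Rightarrow> complex" and N :: nat and H :: "complex \<times> complex \<Rightarrow> complex"
  assumes H: "H (x, y) = x * y + (\<Sum>k\<le>N. a k * x ^ k * y ^ (N - k))"
    and N: "3 \<le> N"
begin

text \<open>All monomials of \<open>H\<close>, the index \<open>Suc N\<close> standing for \<open>x y\<close>.\<close>

definition "monomial_coeff k = (if k = Suc N then 1 else a k)"
definition "exponent_x k = (if k = Suc N then 1 else k)" for k :: nat
definition "exponent_y k = (if k = Suc N then 1 else N - k)"

lemma H_monomials: "H q = (\<Sum>k\<le>Suc N. monomial_coeff k * fst q ^ exponent_x k * snd q ^ exponent_y k)"
  by (cases q) (simp add: H monomial_coeff_def exponent_x_def exponent_y_def)

lemmas partials = partial_x_polynomial[OF H_monomials] partial_y_polynomial[OF H_monomials]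

lemma holo_H: "holomorphic2 H" "holomorphic2 (partial_x H)" "holomorphic2 (partial_y H)"
  by (rule holomorphic2_polynomial[OF H_monomials] holomorphic2_polynomial[OF partials(1)]
      holomorphic2_polynomial[OF partials(2)])+

lemma H_x: "partial_x H (x, y) = y + (\<Sum>k\<le>N. a k * of_nat k * x ^ (k - 1) * y ^ (N - k))"
  by (simp add: partials monomial_coeff_def exponent_x_def exponent_y_def)

lemma H_y: "partial_y H (x, y) = x + (\<Sum>k\<le>N. a k * of_nat (N - k) * x ^ k * y ^ (N - k - 1))"
  by (simp add: partials monomial_coeff_def exponent_x_def exponent_y_def)

lemma H_xx: "partial_x (partial_x H) (x, y) = (\<Sum>k\<le>N. a k * of_nat k * of_nat (k - 1) * x ^ (k - 2) * y ^ (N - k))"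
  by (simp add: partial_x_polynomial[OF partials(1)] monomial_coeff_def exponent_x_def exponent_y_def numeral_2_eq_2)

lemma H_yx: "partial_y (partial_x H) (x, y) = 1 + (\<Sum>k\<le>N. a k * of_nat k * of_nat (N - k) * x ^ (k - 1) * y ^ (N - k - 1))"
  by (simp add: partial_y_polynomial[OF partials(1)] monomial_coeff_def exponent_x_def exponent_y_def)

lemma H_xy: "partial_x (partial_y H) (x, y) = 1 + (\<Sum>k\<le>N. a k * of_nat k * of_nat (N - k) * x ^ (k - 1) * y ^ (N - k - 1))"
  by (simp add: partial_x_polynomial[OF partials(2)] monomial_coeff_def exponent_x_def exponent_y_def mult.commute mult.left_commute)

lemma H_yy: "partial_y (partial_y H) (x, y) = (\<Sum>k\<le>N. a k * of_nat (N - k) * of_nat (N - k - 1) * x ^ k * y ^ (N - k - 2))"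
  by (simp add: partial_y_polynomial[OF partials(2)] monomial_coeff_def exponent_x_def exponent_y_def numeral_2_eq_2)

lemma euler:
  shows "x * partial_x H (x, y) = x * y + (\<Sum>k\<le>N. of_nat k * (a k * x ^ k * y ^ (N - k)))"
    and "y * partial_y H (x, y) = x * y + (\<Sum>k\<le>N. of_nat (N - k) * (a k * x ^ k * y ^ (N - k)))"
proof -
  have *: "x * (a k * of_nat k * x ^ (k - 1) * y ^ (N - k)) = of_nat k * (a k * x ^ k * y ^ (N - k))" for k
    by (cases k) (simp_all add: algebra_simps)
  show "x * partial_x H (x, y) = x * y + (\<Sum>k\<le>N. of_nat k * (a k * x ^ k * y ^ (N - k)))"
    unfolding H_x distrib_left sum_distrib_left * by (rule refl)
  have *: "y * (a k * of_nat (N - k) * x ^ k * y ^ (N - k - 1)) = of_nat (N - k) * (a k * x ^ k * y ^ (N - k))" for k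
    by (cases "N - k") (simp_all add: algebra_simps)
  show "y * partial_y H (x, y) = x * y + (\<Sum>k\<le>N. of_nat (N - k) * (a k * x ^ k * y ^ (N - k)))"
    unfolding H_y distrib_left sum_distrib_left * by (simp only: mult.commute[of y x])
qed

lemma critical_value:
  assumes "partial_x H (x, y) = 0" "partial_y H (x, y) = 0"
  shows "of_nat N * H (x, y) = of_nat (N - 2) * (x * y)"
proof -
  have "x * partial_x H (x, y) + y * partial_y H (x, y) =
      2 * (x * y) + (\<Sum>k\<le>N. (of_nat k + of_nat (N - k)) * (a k * x ^ k * y ^ (N - k)))"
    unfolding euler distrib_right sum.distrib by (simp add: add_ac)
  also have "(\<Sum>k\<le>N. (of_nat k + of_nat (N - k)) * (a k * x ^ k * y ^ (N - k))) = of_nat N * (H (x, y) - x * y)"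
    unfolding H sum_distrib_left add_diff_cancel_left'
    by (intro sum.cong) (auto simp flip: of_nat_add)
  finally have "2 * (x * y) + of_nat N * (H (x, y) - x * y) = 0" using assms by simp
  then have "of_nat N * H (x, y) = (of_nat N - 2) * (x * y)" by (simp add: algebra_simps)
  moreover have "(of_nat (N - 2) :: complex) = of_nat N - 2" using N by (simp add: of_nat_diff)
  ultimately show ?thesis by (simp only:)
qed

text \<open>
  At a critical point with nonzero value \<open>h\<close>, Euler's identities make \<open>h\<close> a fixed multiple of
  \<open>x y\<close> and make \<open>z = x / y\<close> a root of a polynomial that does not vanish identically. For each
  root \<open>z\<close> the power \<open>y ^ (N - 2)\<close> is determined, hence so is \<open>h ^ (N - 2)\<close>; there are
  finitely many such \<open>h\<close>.
\<close>

lemma smooth_near_0: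
  assumes "m \<le> N" "2 * m \<noteq> N" "a m \<noteq> 0"
  shows "\<forall>\<^sub>F h in at 0. \<forall>q\<in>level_curve H h. partial_x H q \<noteq> 0 \<or> partial_y H q \<noteq> 0"
proof -
  define Q where "Q z = (\<Sum>k\<le>N. of_nat k * (a k * z ^ k))" for z
  define Z where "Z = {z. (\<Sum>k\<le>N. ((2 * of_nat k - of_nat N) * a k) * z ^ k) = 0}"
  have "(2 * of_nat m - of_nat N :: complex) \<noteq> 0"
    using assms(2) by (metis eq_iff_diff_eq_0 of_nat_eq_iff of_nat_mult of_nat_numeral)
  then have "finite Z"
    unfolding Z_def Transcendental.polyfun_finite_roots using assms(1,3) by (intro exI[of _ m]) auto
  \<comment> \<open>\<open>w z\<close> is the value of \<open>h ^ (N - 2)\<close> for a critical point with \<open>x = z y\<close>.\<close>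
  define w where "w z = (of_nat (N - 2) / of_nat N * z) ^ (N - 2) * (z / Q z)\<^sup>2" for z
  define crit where "crit = (\<Union>u\<in>w ` Z. {h. h ^ (N - 2) = u}) - {0}"
  have "finite crit"
    unfolding crit_def using \<open>finite Z\<close> N by (intro finite_Diff finite_UN_I finite_imageI finite_nth_roots) auto
  have "h \<in> crit" if h: "h \<noteq> 0" and q: "H (x, y) = h" "partial_x H (x, y) = 0" "partial_y H (x, y) = 0" for h x y
  proof -
    have N0: "of_nat N \<noteq> (0::complex)" using N by simp
    have h_eq: "h = of_nat (N - 2) / of_nat N * (x * y)"
      using critical_value[OF q(2,3)] q(1) N0 by (simp add: field_simps)
    then have xy: "x \<noteq> 0" "y \<noteq> 0" using h by auto
    define z where "z = x / y"
    have x: "x = z * y" and "z \<noteq> 0" using xy by (auto simp: z_def)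
    have hom: "(\<Sum>k\<le>N. f k * (a k * x ^ k * y ^ (N - k))) = y ^ N * (\<Sum>k\<le>N. f k * (a k * z ^ k))" for f
      unfolding sum_distrib_left
    proof (intro sum.cong refl)
      fix k assume "k \<in> {..N}"
      then have "y ^ N = y ^ k * y ^ (N - k)" by (simp flip: power_add)
      then show "f k * (a k * x ^ k * y ^ (N - k)) = y ^ N * (f k * (a k * z ^ k))"
        by (simp add: x power_mult_distrib)
    qed
    have 1: "x * y + y ^ N * Q z = 0"
      using euler(1)[of x y] q(2) unfolding hom by (simp add: Q_def)
    have 2: "x * y + y ^ N * (\<Sum>k\<le>N. of_nat (N - k) * (a k * z ^ k)) = 0"
      using euler(2)[of y x] q(3) unfolding hom by simp
    have "y ^ N * Q z = y ^ N * (\<Sum>k\<le>N. of_nat (N - k) * (a k * z ^ k))"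
      using 1 2 by (metis add_left_cancel)
    moreover have "y ^ N \<noteq> 0" using xy by simp
    ultimately have "Q z = (\<Sum>k\<le>N. of_nat (N - k) * (a k * z ^ k))"
      by (rule mult_left_cancel[THEN iffD1, rotated])
    then have "Q z - (\<Sum>k\<le>N. of_nat (N - k) * (a k * z ^ k)) = 0"
      by (rule right_minus_eq[THEN iffD2])
    moreover have "Q z - (\<Sum>k\<le>N. of_nat (N - k) * (a k * z ^ k)) = (\<Sum>k\<le>N. ((2 * of_nat k - of_nat N) * a k) * z ^ k)"
      unfolding Q_def sum_subtractf[symmetric] by (intro sum.cong) (auto simp: of_nat_diff algebra_simps)
    ultimately have "z \<in> Z" unfolding Z_def by (intro CollectI) (simp only:)
    have "2 + (N - 2) = N" using N by simp
    then have "y ^ N = y\<^sup>2 * y ^ (N - 2)" by (metis power_add)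
    then have "y\<^sup>2 * (z + y ^ (N - 2) * Q z) = 0"
      using 1 by (simp add: x power2_eq_square algebra_simps)
    then have Q: "y ^ (N - 2) * Q z = - z" using xy by (simp add: eq_neg_iff_add_eq_0 add.commute)
    then have "Q z \<noteq> 0" using \<open>z \<noteq> 0\<close> by auto
    then have y: "y ^ (N - 2) = - z / Q z" using Q by (simp add: field_simps)
    have "(c * (z * y * y)) ^ m = (c * z) ^ m * (y ^ m)\<^sup>2" for c :: complex and m
      by (simp add: power_mult_distrib power2_eq_square mult_ac)
    then have "h ^ (N - 2) = (of_nat (N - 2) / of_nat N * z) ^ (N - 2) * (y ^ (N - 2))\<^sup>2"
      unfolding h_eq x .
    also have "\<dots> = w z" by (simp add: y w_def)
    finally show ?thesis using \<open>z \<in> Z\<close> h by (auto simp: crit_def)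
  qed
  then have *: "h \<notin> crit \<Longrightarrow> h \<noteq> 0 \<Longrightarrow> \<forall>q\<in>level_curve H h. partial_x H q \<noteq> 0 \<or> partial_y H q \<noteq> 0" for h
    unfolding level_curve_def by fastforce
  have "open (- crit)" using \<open>finite crit\<close> by (intro open_Compl finite_imp_closed)
  moreover have "0 \<in> - crit" by (simp add: crit_def)
  ultimately have "\<forall>\<^sub>F h in nhds 0. h \<in> - crit" by (rule eventually_nhds_in_open)
  then show ?thesis
    unfolding eventually_at_filter by eventually_elim (use * in auto)
qed

lemma sum_single_term:
  fixes f :: "nat \<Rightarrow> complex"
  assumes "m \<le> N" "\<And>k. k \<le> N \<Longrightarrow> k \<noteq> m \<Longrightarrow> f k = 0"
  shows "(\<Sum>k\<le>N. f k) = f m"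
  using sum.mono_neutral_right[of "{..N}" "{m}" f] assms by auto

lemma singular_point_on_axis:
  assumes "H (x, y) = 0" "partial_x H (x, y) = 0" "partial_y H (x, y) = 0"
  shows "x = 0 \<or> y = 0"
proof -
  have "(of_nat (N - 2) :: complex) \<noteq> 0"
    using N by (subst of_nat_eq_0_iff) simp
  moreover have "of_nat (N - 2) * (x * y) = 0"
    using critical_value[OF assms(2,3)] assms(1) by (metis mult_zero_right)
  ultimately show ?thesis by (metis mult_eq_0_iff)
qed

text \<open>
  The vanishing of the gradient determines the coefficients of \<open>x ^ N\<close> and \<open>x ^ (N - 1) * y\<close>, and these
  are the only ones that enter \<open>H\<^sub>x\<^sub>x\<close> and the mixed derivative on the axis.
\<close>

lemma singular_point_x_axis:
  assumes "partial_x H (x, 0) = 0" "partial_y H (x, 0) = 0" "x \<noteq> 0"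
  shows "a (N - 1) \<noteq> 0" "partial_x (partial_x H) (x, 0) = 0"
    "partial_x (partial_y H) (x, 0) = 2 - of_nat N" "partial_y (partial_x H) (x, 0) = 2 - of_nat N"
proof -
  have "(\<Sum>k\<le>N. a k * of_nat k * x ^ (k - 1) * 0 ^ (N - k)) = a N * of_nat N * x ^ (N - 1)"
    by (subst sum_single_term[of N]) auto
  then have aN: "a N = 0" using assms(1,3) N by (simp add: H_x)
  have "(\<Sum>k\<le>N. a k * of_nat (N - k) * x ^ k * 0 ^ (N - k - 1)) = a (N - 1) * x ^ (N - 1)"
    by (subst sum_single_term[of "N - 1"]) (use N in \<open>auto simp: power_0_left\<close>)
  then have 1: "x + a (N - 1) * x ^ (N - 1) = 0" using assms(2) by (simp add: H_y)
  then show "a (N - 1) \<noteq> 0" using assms(3) by auto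
  have "x ^ (N - 1) = x * x ^ (N - 2)" using N by (simp flip: power_Suc add: Suc_diff_le numeral_2_eq_2 Suc_diff_Suc)
  then have "x * (1 + a (N - 1) * x ^ (N - 2)) = 0" using 1 by (simp add: algebra_simps)
  then have 2: "a (N - 1) * x ^ (N - 2) = - 1" using assms(3) by (simp add: eq_neg_iff_add_eq_0 add.commute)
  show "partial_x (partial_x H) (x, 0) = 0"
    unfolding H_xx by (subst sum_single_term[of N]) (auto simp: aN)
  have 3: "(\<Sum>k\<le>N. a k * of_nat k * of_nat (N - k) * x ^ (k - 1) * 0 ^ (N - k - 1)) = 1 - of_nat N"
  proof -
    have "(\<Sum>k\<le>N. a k * of_nat k * of_nat (N - k) * x ^ (k - 1) * 0 ^ (N - k - 1)) = of_nat (N - 1) * (a (N - 1) * x ^ (N - 2))"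
      by (subst sum_single_term[of "N - 1"]) (use N in \<open>auto simp: power_0_left numeral_2_eq_2\<close>)
    also have "\<dots> = 1 - of_nat N" unfolding 2 using N by (simp add: of_nat_diff)
    finally show ?thesis .
  qed
  show "partial_x (partial_y H) (x, 0) = 2 - of_nat N" "partial_y (partial_x H) (x, 0) = 2 - of_nat N"
    unfolding H_xy H_yx 3 by simp_all
qed

lemma singular_point_y_axis:
  assumes "partial_x H (0, y) = 0" "partial_y H (0, y) = 0" "y \<noteq> 0"
  shows "a 1 \<noteq> 0" "partial_y (partial_y H) (0, y) = 0"
    "partial_x (partial_y H) (0, y) = 2 - of_nat N" "partial_y (partial_x H) (0, y) = 2 - of_nat N"
proof -
  have "(\<Sum>k\<le>N. a k * of_nat (N - k) * 0 ^ k * y ^ (N - k - 1)) = a 0 * of_nat N * y ^ (N - 1)"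
    by (subst sum_single_term[of 0]) auto
  then have a0: "a 0 = 0" using assms(2,3) N by (simp add: H_y)
  have "(\<Sum>k\<le>N. a k * of_nat k * 0 ^ (k - 1) * y ^ (N - k)) = a 1 * y ^ (N - 1)"
    by (subst sum_single_term[of 1]) (use N in \<open>auto simp: power_0_left\<close>)
  then have 1: "y + a 1 * y ^ (N - 1) = 0" using assms(1) by (simp add: H_x)
  then show "a 1 \<noteq> 0" using assms(3) by auto
  have "y ^ (N - 1) = y * y ^ (N - 2)" using N by (simp flip: power_Suc add: Suc_diff_le numeral_2_eq_2 Suc_diff_Suc)
  then have "y * (1 + a 1 * y ^ (N - 2)) = 0" using 1 by (simp add: algebra_simps)
  then have 2: "a 1 * y ^ (N - 2) = - 1" using assms(3) by (simp add: eq_neg_iff_add_eq_0 add.commute)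
  show "partial_y (partial_y H) (0, y) = 0"
    unfolding H_yy by (subst sum_single_term[of 0]) (auto simp: a0)
  have 3: "(\<Sum>k\<le>N. a k * of_nat k * of_nat (N - k) * 0 ^ (k - 1) * y ^ (N - k - 1)) = 1 - of_nat N"
  proof -
    have "(\<Sum>k\<le>N. a k * of_nat k * of_nat (N - k) * 0 ^ (k - 1) * y ^ (N - k - 1)) = of_nat (N - 1) * (a 1 * y ^ (N - 2))"
      by (subst sum_single_term[of 1]) (use N in \<open>auto simp: power_0_left numeral_2_eq_2\<close>)
    also have "\<dots> = 1 - of_nat N" unfolding 2 using N by (simp add: of_nat_diff)
    finally show ?thesis .
  qed
  show "partial_x (partial_y H) (0, y) = 2 - of_nat N" "partial_y (partial_x H) (0, y) = 2 - of_nat N"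
    unfolding H_xy H_yx 3 by simp_all
qed

text \<open>
  On each axis the linearization is triangular with diagonal entries \<open>\<plusminus> (N - 2)\<close>, by the two
  preceding lemmas, and only one of them is positive.
\<close>

lemma positive_eigenvalue:
  assumes sing: "partial_x H p = 0" "partial_y H p = 0" and axis: "fst p = 0 \<or> snd p = 0" and p: "p \<noteq> (0, 0)"
    and l: "eigen_coordinate H p (of_real \<mu>) l" and \<mu>: "\<mu> > 0"
  shows "of_real \<mu> = (of_nat N - 2 :: complex)"
proof -
  obtain \<alpha> \<beta> where nz: "(\<alpha>, \<beta>) \<noteq> (0, 0)" and l_def: "l = (\<lambda>w. \<alpha> * fst w + \<beta> * snd w)"
    and eigen: "\<And>w. l (linearization H p w) = of_real \<mu> * l w"
    using l unfolding eigen_coordinate_def by blast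
  define xx xy yx yy where "xx = partial_x (partial_x H) p" and "xy = partial_x (partial_y H) p"
    and "yx = partial_y (partial_x H) p" and "yy = partial_y (partial_y H) p"
  have e: "\<alpha> * xy - \<beta> * xx = of_real \<mu> * \<alpha>" "\<alpha> * yy - \<beta> * yx = of_real \<mu> * \<beta>"
    using eigen[of "(1, 0)"] eigen[of "(0, 1)"] by (simp_all add: l_def linearization_def xx_def xy_def yx_def yy_def)
  have neg: "of_real \<mu> \<noteq> (2 - of_nat N :: complex)"
  proof
    assume "of_real \<mu> = (2 - of_nat N :: complex)"
    then have "(of_real \<mu> :: complex) = of_real (2 - of_nat N)" by simp
    then have "\<mu> = 2 - of_nat N" by (rule of_real_eq_iff[THEN iffD1])
    then show False using \<mu> N by simp
  qed
  have off: "xy = 2 - of_nat N \<and> yx = 2 - of_nat N \<and> (xx = 0 \<or> yy = 0)"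
  proof (cases "fst p = 0")
    case True
    then obtain y where "p = (0, y)" "y \<noteq> 0" using p by (cases p) auto
    then show ?thesis
      using singular_point_y_axis[of y] sing by (simp add: xx_def xy_def yx_def yy_def)
  next
    case False
    then obtain x where "p = (x, 0)" "x \<noteq> 0" using axis by (cases p) auto
    then show ?thesis
      using singular_point_x_axis[of x] sing by (simp add: xx_def xy_def yx_def yy_def)
  qed
  show ?thesis
  proof (cases "xx = 0")
    case True
    then have "\<alpha> = 0" using e(1) off neg by auto
    then have "\<beta> * (of_nat N - 2) = \<beta> * of_real \<mu>" "\<beta> \<noteq> 0"
      using e(2) off nz by (auto simp: algebra_simps)
    then show ?thesis by (metis mult_cancel_left)
  next
    case False
    then have "yy = 0" using off by blast
    then have "\<beta> * (of_nat N - 2) = \<beta> * of_real \<mu>" using e(2) off by (simp add: algebra_simps)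
    moreover have "\<beta> \<noteq> 0"
    proof
      assume "\<beta> = 0"
      then show False using e(1) off neg nz by auto
    qed
    ultimately show ?thesis by (metis mult_cancel_left)
  qed
qed

text \<open>
  A singular point on an axis, but not at the origin, rules out \<open>H = x y + c (x y) ^ m\<close>, the only case
  excluded in \<open>smooth_near_0\<close>.
\<close>

lemma smooth_near_0_if_singular_point:
  assumes "partial_x H p = 0" "partial_y H p = 0" "fst p = 0 \<or> snd p = 0" "p \<noteq> (0, 0)"
  shows "\<forall>\<^sub>F h in at 0. \<forall>q\<in>level_curve H h. partial_x H q \<noteq> 0 \<or> partial_y H q \<noteq> 0"
proof (cases "fst p = 0")
  case True
  then obtain y where y: "p = (0, y)" "y \<noteq> 0" using assms(4) by (cases p) auto
  then have "a 1 \<noteq> 0" using singular_point_y_axis(1)[of y] assms(1,2) by blast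
  then show ?thesis using N by (intro smooth_near_0[of 1]) auto
next
  case False
  then obtain x where x: "p = (x, 0)" "x \<noteq> 0" using assms(3) by (cases p) auto
  then have "a (N - 1) \<noteq> 0" using singular_point_x_axis(1)[of x] assms(1,2) by blast
  then show ?thesis using N by (intro smooth_near_0[of "N - 1"]) auto
qed

end

theorem theorem3:
  fixes n :: nat
    and Hn1 H :: "complex \<times> complex \<Rightarrow> complex"
    and Oj :: "complex \<times> complex"
    and \<gamma>j :: "complex \<Rightarrow> (complex \<times> complex) chain set"
  assumes "n \<ge> 2"
    and "homogeneous_form (n + 1) Hn1"
    and "\<And>x y. H (x, y) = x * y + Hn1 (x, y)"
    and "Oj isolated_in singular_points H"
    and "Oj \<in> level_curve H 0"
    and "Oj \<noteq> (0, 0)"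
    and "vanishing_cycle H Oj \<gamma>j"
    and "positively_oriented H Oj \<gamma>j"
  shows "((\<lambda>h. period H h (\<gamma>j h)) \<longlongrightarrow> 2 * of_real pi * \<i> / (of_nat n - 1)) (at 0)"
proof -
  obtain a where "\<And>x y. Hn1 (x, y) = (\<Sum>k\<le>n + 1. a k * x ^ k * y ^ (n + 1 - k))"
    using assms(2) unfolding homogeneous_form_def by blast
  then interpret saddle_plus_form a "n + 1" H
    using assms(1,3) by unfold_locales simp_all
  have "Oj \<in> singular_points H" using assms(4) by (simp add: isolated_in_def)
  then have sing: "partial_x H Oj = 0" "partial_y H Oj = 0"
    by (auto simp: singular_points_def ham_field_def zero_prod_def)
  have H0: "H Oj = 0" using assms(5) by (simp add: level_curve_def)
  have axis: "fst Oj = 0 \<or> snd Oj = 0"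
    using singular_point_on_axis[of "fst Oj" "snd Oj"] sing H0 by simp
  obtain \<gamma> C l and \<mu> :: real where \<gamma>: "vanishing_loops H Oj \<gamma>" "represents H \<gamma> \<gamma>j"
    and ev: "\<forall>\<^sub>F h in at 0. loop_length (\<gamma> h) \<le> C * sqrt (cmod h) \<and>
                             path_image (\<gamma> h) \<subseteq> cball Oj (C * sqrt (cmod h))"
      "\<forall>\<^sub>F h in at 0. 0 \<notin> path_image (\<lambda>t. l (\<gamma> h t - Oj)) \<and>
                      winding_number (\<lambda>t. l (\<gamma> h t - Oj)) 0 = 1"
    and \<mu>: "\<mu> > 0" and l: "eigen_coordinate H Oj (of_real \<mu>) l"
    using assms(8) unfolding positively_oriented_def by (elim exE conjE) (rule that)
  obtain \<delta> where "\<delta> > 0" "\<forall>h\<in>ball 0 \<delta> - {0}. C1_loop_in (level_curve H h) (\<gamma> h)"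
    using \<gamma>(1) unfolding vanishing_loops_def by blast
  then have loops: "\<forall>\<^sub>F h in at 0. C1_loop_in (level_curve H h) (\<gamma> h)"
    by (auto simp: eventually_at dist_commute intro!: exI[of _ \<delta>])
  have "of_real \<mu> = (of_nat n - 1 :: complex)"
    using positive_eigenvalue[OF sing axis assms(6) l \<mu>] by simp
  moreover have "((\<lambda>h. period H h (\<gamma>j h)) \<longlongrightarrow> 2 * of_real pi * \<i> / of_real \<mu>) (at 0)"
  proof (rule vanishing_cycle_period[OF holo_H H0 sing _ loops \<gamma>(2) _ l])
    show "\<forall>\<^sub>F h in at 0. \<forall>q\<in>level_curve H h. partial_x H q \<noteq> 0 \<or> partial_y H q \<noteq> 0"
      by (rule smooth_near_0_if_singular_point[OF sing axis assms(6)])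
    show "\<forall>\<^sub>F h in at 0. path_image (\<gamma> h) \<subseteq> cball Oj (C * sqrt (cmod h))"
      using ev(1) by (rule eventually_mono) blast
    show "\<forall>\<^sub>F h in at 0. winding_number (\<lambda>t. l (\<gamma> h t - Oj)) 0 = 1"
      using ev(2) by (rule eventually_mono) blast
  qed (use \<mu> in simp)
  ultimately show ?thesis by simp
qed

end
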